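(* Let $\nu$ be a compactly supported Borel probability measure on $\mathbb{R}^{d}$. If $\sup_{x\in(0,1)}\beta_{\nu}(x)>0$, then for every $r>0$, \[ \frac{r\underline{F}_{r}}{1-\underline{F}_{r}}\leq\underline{D}_{r}(\nu)\leq\frac{r\underline{h}_{r}}{1-\underline{h}_{r}}\leq\overline{D}_{r}(\nu)=\overline{\mathfrak{R}}_{\nu}(q_{r}). \] Otherwise, if $\beta_{\nu}(x)=0$ for all $x>0$, then for all $r\geq0$ the quantization dimension $D_{r}(\nu)$ exists and $D_{r}(\nu)=0$.
   Context: Let $\Lambda$ be Lebesgue measure on $\mathbb{R}^d$, $\|\cdot\|$ the Euclidean norm, $\mathcal{Q}=(0,1]^d$. For $n\in\mathbb{N}$ let $\mathcal{D}_n$ be the partition of $\mathbb{R}^d$ into half-open cubes $\prod_{i=1}^d(k_i2^{-n},(k_i+1)2^{-n}]$, $k\in\mathbb{Z}^d$, and $\mathcal{D}=\bigcup_{n\in\mathbb{N}}\mathcal{D}_n$. Quantization dimensions: let $\mathcal{A}_n=\{\alpha\subset\mathbb{R}^d:1\le\mathrm{card}(\alpha)\le n\}$, $d(x,\alpha)=\min_{y\in\alpha}\|x-y\|$, $\mathfrak{e}_{n,r}(\nu)=\inf_{\alpha\in\mathcal{A}_n}\left(\int d(x,\alpha)^r\,d\nu(x)\right)^{1/r}$ for $r>0$ and $\mathfrak{e}_{n,0}(\nu)=\inf_{\alpha\in\mathcal{A}_n}\exp\int\log d(x,\alpha)\,d\nu(x)$. The upper and lower quantization dimensions of order $r$ are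 $\overline{D}_r(\nu)=\limsup_{n\to\infty}\frac{\log n}{-\log\mathfrak{e}_{n,r}(\nu)}$ and $\underline{D}_r(\nu)=\liminf_{n\to\infty}\frac{\log n}{-\log\mathfrak{e}_{n,r}(\nu)}$ (the quotient is $0$ if $\mathfrak{e}_{n,r}(\nu)=0$). If they agree, the common value is $D_r(\nu)$. $L^q$-spectrum: for $q\ge0$, $\beta_{\nu}(q)=\limsup_{n\to\infty}\beta_{\nu,n}(q)$, $\beta_{\nu,n}(q)=\frac{\log\left(\sum_{C\in\mathcal{D}_n}\nu(C)^q\right)}{\log(2^n)}$ (with $0^0=0$). For $r>0$, $q_r=\inf\{q>0:\beta_\nu(q)<rq\}$. Rényi dimension: $\overline{\mathfrak{R}}_{\nu}(q)=\beta_\nu(q)/(1-q)$ for $q\ge 0$, $q\neq1$, and $\overline{\mathfrak{R}}_{\nu}(1)=\limsup_{n}\frac{\sum_{C\in\mathcal{D}_n}\nu(C)\log\nu(C)}{\log(2^{-n})}$. Lower optimized coarse multifractal dimension: for $\alpha>0$, $\mathcal{N}_{\nu,\alpha,r}(n)=\mathrm{card}\{Q\in\mathcal{D}_n:\nu(Q)\Lambda(Q)^{r/d}\ge2^{-\alpha n}\}$, $\underline{F}_{\nu,r}(\alpha)=\liminf_{n}\frac{\log^+(\mathcal{N}_{\nu,\alpha,r}(n))}{\log 2^n}$ with $\log^+(y)=\max\{\log y,0\}$, $\log^+(0)=0$, and $\underline{F}_r=\underline{F}_{\nu,r}=\sup_{\alpha>0}\underline{F}_{\nu,r}(\alpha)/\alpha$.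 Lower partition entropy: if $\mathrm{supp}(\nu)\subset\mathcal{Q}$, let $\Pi_\nu$ be the set of finite collections $P$ of dyadic cubes for which there is a partition $\tilde P$ of $\mathcal{Q}$ by cubes from $\mathcal{D}$ with $P=\{Q\in\tilde P:\nu(Q)>0\}$. Put $\mathcal{M}_{\nu,r}(x)=\inf\{\mathrm{card}(P):P\in\Pi_\nu,\ \max_{Q\in P}\nu(Q)\Lambda(Q)^{r/d}<1/x\}$ and $\underline{h}_r=\underline{h}_{\nu,r}=\liminf_{x\to\infty}\frac{\log\mathcal{M}_{\nu,r}(x)}{\log x}$. For general compactly supported $\nu$, $\underline{h}_{\nu,r}$ is understood as $\underline{h}_{\nu\circ\Phi^{-1},r}$ for a map $\Phi(x)=ax+b$ ($a\in\mathbb{R}\setminus\{0\}$, $b\in\mathbb{R}^d$) with $\Phi(\mathrm{supp}(\nu))\subset\mathcal{Q}$; the statement is for any such choice (quantization dimensions are invariant under such maps). *)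

theory Defs
  imports "HOL-Probability.Probability"
begin

section \<open>Support and dyadic cubes\<close>

definition measure_support :: "'a::topological_space measure \<Rightarrow> 'a set" where
  "measure_support \<nu> = {x. \<forall>U. open U \<and> x \<in> U \<longrightarrow> emeasure \<nu> U > 0}"

definition dyadic_cube :: "nat \<Rightarrow> ('d::finite \<Rightarrow> int) \<Rightarrow> (real^'d) set" where
  "dyadic_cube n k =
     {x. \<forall>i. of_int (k i) / 2 ^ n < x $ i \<and> x $ i \<le> (of_int (k i) + 1) / 2 ^ n}"

definition dyadic_level :: "nat \<Rightarrow> (real^'d::finite) set set" where
  "dyadic_level n = range (dyadic_cube n)"

text \<open>Level 0 is included, so the unit cube is itself dyadic. This affects none of the
  asymptotic quantities below.\<close>

definition dyadic_cubes :: "(real^'d::finite) set set" where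
  "dyadic_cubes = (\<Union>n. dyadic_level n)"

definition half_open_unit_cube :: "(real^'d::finite) set" where
  "half_open_unit_cube = {x. \<forall>i. 0 < x $ i \<and> x $ i \<le> 1}"


section \<open>Quantization dimensions\<close>

definition codebooks :: "nat \<Rightarrow> (real^'d::finite) set set" where
  "codebooks n = {\<alpha>. finite \<alpha> \<and> 1 \<le> card \<alpha> \<and> card \<alpha> \<le> n}"

text \<open>The integral of \<open>log d(x,\<alpha>)\<close>, with \<open>log 0 = -\<infinity>\<close>, as the difference of the integrals of the
  positive and negative parts. It may equal \<open>-\<infinity>\<close>, for instance if \<open>\<nu>\<close> has an atom in \<open>\<alpha>\<close>;
  it is never \<open>+\<infinity>\<close> for compactly supported \<open>\<nu>\<close>.\<close>

definition log_infdist :: "(real^'d::finite) set \<Rightarrow> real^'d \<Rightarrow> ereal" where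
  "log_infdist \<alpha> x = (if infdist x \<alpha> = 0 then -\<infinity> else ereal (ln (infdist x \<alpha>)))"

definition log_distortion :: "(real^'d::finite) measure \<Rightarrow> (real^'d) set \<Rightarrow> ereal" where
  "log_distortion \<nu> \<alpha> =
     enn2ereal (\<integral>\<^sup>+ x. e2ennreal (log_infdist \<alpha> x) \<partial>\<nu>) -
     enn2ereal (\<integral>\<^sup>+ x. e2ennreal (- log_infdist \<alpha> x) \<partial>\<nu>)"

text \<open>The error of a single codebook, with \<open>exp (-\<infinity>) = 0\<close> for order \<open>r = 0\<close>. It is meant for
  compactly supported \<open>\<nu>\<close>, for which the integral of order \<open>r > 0\<close> is finite.\<close>

definition codebook_error :: "(real^'d::finite) measure \<Rightarrow> real \<Rightarrow> (real^'d) set \<Rightarrow> real" where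
  "codebook_error \<nu> r \<alpha> =
     (if r = 0
      then (if log_distortion \<nu> \<alpha> = -\<infinity> then 0 else exp (real_of_ereal (log_distortion \<nu> \<alpha>)))
      else (\<integral>x. infdist x \<alpha> powr r \<partial>\<nu>) powr (1 / r))"

definition quantization_error :: "(real^'d::finite) measure \<Rightarrow> real \<Rightarrow> nat \<Rightarrow> real" where
  "quantization_error \<nu> r n = (INF \<alpha>\<in>codebooks n. codebook_error \<nu> r \<alpha>)"

definition quantization_quotient :: "(real^'d::finite) measure \<Rightarrow> real \<Rightarrow> nat \<Rightarrow> real" where
  "quantization_quotient \<nu> r n =
     (if quantization_error \<nu> r n = 0 then 0
      else ln (real n) / (- ln (quantization_error \<nu> r n)))"

definition upper_quantization_dim :: "(real^'d::finite) measure \<Rightarrow> real \<Rightarrow> ereal" where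
  "upper_quantization_dim \<nu> r = limsup (\<lambda>n. ereal (quantization_quotient \<nu> r n))"

definition lower_quantization_dim :: "(real^'d::finite) measure \<Rightarrow> real \<Rightarrow> ereal" where
  "lower_quantization_dim \<nu> r = liminf (\<lambda>n. ereal (quantization_quotient \<nu> r n))"

definition has_quantization_dim :: "(real^'d::finite) measure \<Rightarrow> real \<Rightarrow> ereal \<Rightarrow> bool" where
  "has_quantization_dim \<nu> r D \<longleftrightarrow>
     lower_quantization_dim \<nu> r = D \<and> upper_quantization_dim \<nu> r = D"


section \<open>The \<open>L\<^sup>q\<close>-spectrum and the Renyi dimension\<close>

text \<open>The convention \<open>0\<^sup>0 = 0\<close> agrees with \<open>0 powr 0 = 0\<close>.\<close>

definition Lq_spectrum_level :: "(real^'d::finite) measure \<Rightarrow> nat \<Rightarrow> real \<Rightarrow> real" where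
  "Lq_spectrum_level \<nu> n q =
     ln (\<Sum>\<^sub>\<infinity>C\<in>dyadic_level n. measure \<nu> C powr q) / ln (2 ^ n)"

definition Lq_spectrum :: "(real^'d::finite) measure \<Rightarrow> real \<Rightarrow> ereal" where
  "Lq_spectrum \<nu> q = limsup (\<lambda>n. ereal (Lq_spectrum_level \<nu> n q))"

definition critical_exponent :: "(real^'d::finite) measure \<Rightarrow> real \<Rightarrow> real" where
  "critical_exponent \<nu> r = Inf {q. q > 0 \<and> Lq_spectrum \<nu> q < ereal (r * q)}"

definition upper_renyi_dim :: "(real^'d::finite) measure \<Rightarrow> real \<Rightarrow> ereal" where
  "upper_renyi_dim \<nu> q =
     (if q = 1
      then limsup (\<lambda>n. ereal ((\<Sum>\<^sub>\<infinity>C\<in>dyadic_level n. measure \<nu> C * ln (measure \<nu> C))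
                              / ln (1 / 2 ^ n)))
      else Lq_spectrum \<nu> q / ereal (1 - q))"


section \<open>Lower optimized coarse multifractal dimension\<close>

definition cube_weight :: "(real^'d::finite) measure \<Rightarrow> real \<Rightarrow> (real^'d) set \<Rightarrow> real" where
  "cube_weight \<nu> r C = measure \<nu> C * measure lborel C powr (r / real CARD('d))"

definition heavy_cube_count :: "(real^'d::finite) measure \<Rightarrow> real \<Rightarrow> real \<Rightarrow> nat \<Rightarrow> nat" where
  "heavy_cube_count \<nu> \<alpha> r n =
     card {C \<in> dyadic_level n. cube_weight \<nu> r C \<ge> 2 powr (- \<alpha> * real n)}"

text \<open>Here \<open>log\<^sup>+ 0 = 0\<close> holds because \<open>ln 0 = 0\<close>.\<close>

definition lower_coarse_dim_at :: "(real^'d::finite) measure \<Rightarrow> real \<Rightarrow> real \<Rightarrow> ereal" where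
  "lower_coarse_dim_at \<nu> r \<alpha> =
     liminf (\<lambda>n. ereal (max (ln (real (heavy_cube_count \<nu> \<alpha> r n))) 0 / ln (2 ^ n)))"

definition lower_coarse_dim :: "(real^'d::finite) measure \<Rightarrow> real \<Rightarrow> ereal" where
  "lower_coarse_dim \<nu> r = (SUP \<alpha>\<in>{0<..}. lower_coarse_dim_at \<nu> r \<alpha> / ereal \<alpha>)"


section \<open>Lower partition entropy\<close>

definition dyadic_partitions :: "(real^'d::finite) measure \<Rightarrow> (real^'d) set set set" where
  "dyadic_partitions \<nu> =
     {P. finite P \<and>
         (\<exists>P'. P' \<subseteq> dyadic_cubes \<and> partition_on half_open_unit_cube P' \<and>
               P = {C \<in> P'. measure \<nu> C > 0})}"

definition min_partition_card :: "(real^'d::finite) measure \<Rightarrow> real \<Rightarrow> real \<Rightarrow> nat" where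
  "min_partition_card \<nu> r x =
     Inf {card P | P. P \<in> dyadic_partitions \<nu> \<and> Max (cube_weight \<nu> r ` P) < 1 / x}"

text \<open>Meant for \<open>\<nu>\<close> with support contained in the half-open unit cube.\<close>

definition lower_partition_entropy :: "(real^'d::finite) measure \<Rightarrow> real \<Rightarrow> ereal" where
  "lower_partition_entropy \<nu> r =
     Liminf at_top (\<lambda>x::real. ereal (ln (real (min_partition_card \<nu> r x)) / ln x))"

end

theory Submission
  imports Defs "HOL-Real_Asymp.Real_Asymp"
begin

text \<open>
  All bounds pass through the weights \<open>\<nu>(Q) \<Lambda>(Q)\<^sup>r\<^sup>/\<^sup>d = \<nu>(Q) 2\<^sup>-\<^sup>n\<^sup>r\<close> of dyadic cubes of level \<open>n\<close>.
  A cover by \<open>N\<close> cubes of weight at most \<open>t\<close> gives an \<open>N\<close>-point codebook with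
  \<open>r\<close>-th power error of order at most \<open>N t\<close>. Conversely, given \<open>N\<close> cubes of one common level with
  weight at least \<open>t\<close>, every codebook of at most \<open>c N\<close> points leaves half of them without a nearby
  codebook point, so its \<open>r\<close>-th power error is at least \<open>t N / 2\<close>. In both cases
  \<open>N = t\<^sup>-\<^sup>q\<close> corresponds to the quantization dimension \<open>r q / (1 - q)\<close>.

  If \<open>\<beta>(q) < r q\<close>, then the sum of the \<open>q\<close>-th powers of all weights converges, and the cubes at which
  the weight first drops below \<open>t\<close> form a cover by \<open>O(t\<^sup>-\<^sup>q)\<close> cubes. If \<open>\<beta>(q) > r q\<close>, then a
  decomposition into dyadic bands produces, for infinitely many levels, at least \<open>t\<^sup>-\<^sup>p\<close> cubes of
  weight at least \<open>t\<close> for a given \<open>p < q\<close>. Convexity of \<open>\<beta>\<close> makes \<open>\<beta>(q) = r q\<close> at the critical exponent.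
\<close>

section \<open>Dyadic cubes\<close>

text \<open>The expression r q / (1 - q) arises by eliminating t: N = t^(-q) cubes of weight about t
  give the r-th power error N t = N^(-(1 - q) / q), so log N / (- log e) is r q / (1 - q). Each
  inequality thus becomes a power law for the errors. Whether it holds for all large m or only for
  infinitely many depends on the hypothesis: exponents above the critical one and the coarse
  dimension control all large levels, whereas exponents below it and the entropy give information
  only at infinitely many levels or scales. The power laws are proved for exponents strictly on one
  side, and continuity of q -> r q / (1 - q) on q < 1 yields the endpoint. So all exponents must
  stay below 1: the critical one does by counting cubes, the entropy is at most the critical
  exponent by stopping partitions, and the coarse dimension is so by comparing the dimensions
  themselves. The entropy lives on an affine image of the measure. What is carried back is the
  error, at the cost of a factor \<bar>a\<bar>, which leaves exponents unchanged.\<close>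

definition dyadic_index :: "nat \<Rightarrow> real^'d::finite \<Rightarrow> 'd \<Rightarrow> int" where
  "dyadic_index n x = (\<lambda>i. \<lceil>2 ^ n * x $ i\<rceil> - 1)"

text \<open>The cubes are open on the left and closed on the right, hence ceiling minus one in
  \<open>dyadic_index\<close>. With membership an equation between indices, disjointness and
  injectivity on one level become trivial.\<close>

lemma mem_dyadic_cube_iff: "x \<in> dyadic_cube n k \<longleftrightarrow> dyadic_index n x = k"
proof -
  have "of_int (k i) / 2 ^ n < x $ i \<and> x $ i \<le> (of_int (k i) + 1) / 2 ^ n
          \<longleftrightarrow> \<lceil>2 ^ n * x $ i\<rceil> - 1 = k i" for i
  proof -
    have "\<lceil>2 ^ n * x $ i\<rceil> - 1 = k i \<longleftrightarrow> \<lceil>2 ^ n * x $ i\<rceil> = k i + 1"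
      by auto
    also have "\<dots> \<longleftrightarrow> of_int (k i) < 2 ^ n * x $ i \<and> 2 ^ n * x $ i \<le> of_int (k i) + 1"
      by (simp add: ceiling_eq_iff)
    also have "\<dots> \<longleftrightarrow> of_int (k i) / 2 ^ n < x $ i \<and> x $ i \<le> (of_int (k i) + 1) / 2 ^ n"
      by (simp add: field_simps)
    finally show ?thesis ..
  qed
  then show ?thesis
    by (auto simp: dyadic_cube_def dyadic_index_def fun_eq_iff)
qed

lemma mem_dyadic_cube_self: "x \<in> dyadic_cube n (dyadic_index n x)"
  by (simp add: mem_dyadic_cube_iff)

text \<open>Integer \<open>div\<close> rounds down for negative indices too, so this one formula for
  the parent cube is valid in all orthants.\<close>

lemma dyadic_index_Suc: "dyadic_index n x i = dyadic_index (Suc n) x i div 2"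
proof -
  define m where "m = dyadic_index (Suc n) x i"
  have "x \<in> dyadic_cube (Suc n) (dyadic_index (Suc n) x)"
    by (rule mem_dyadic_cube_self)
  then have "of_int m / 2 ^ Suc n < x $ i" "x $ i \<le> (of_int m + 1) / 2 ^ Suc n"
    unfolding dyadic_cube_def m_def by auto
  then have 1: "of_int m < 2 * (2 ^ n * x $ i)" "2 * (2 ^ n * x $ i) \<le> of_int m + 1"
    by (auto simp: field_simps)
  have *: "real_of_int m \<ge> 2 * of_int (m div 2)" "real_of_int m + 1 \<le> 2 * of_int (m div 2) + 2"
    by linarith+
  have "\<lceil>2 ^ n * x $ i\<rceil> = m div 2 + 1"
    unfolding ceiling_eq_iff using 1 * by linarith
  then show ?thesis by (simp add: dyadic_index_def m_def)
qed

lemma dyadic_index_parent: "dyadic_index n x = (\<lambda>i. dyadic_index (Suc n) x i div 2)"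
  using dyadic_index_Suc by auto

lemma dyadic_cube_subset_parent: "dyadic_cube (Suc n) k \<subseteq> dyadic_cube n (\<lambda>i. k i div 2)"
  by (auto simp: mem_dyadic_cube_iff dyadic_index_parent[of n])

lemma dyadic_cube_nested: "m \<le> n \<Longrightarrow> dyadic_cube n (dyadic_index n x) \<subseteq> dyadic_cube m (dyadic_index m x)"
proof (induction n rule: dec_induct)
  case (step n)
  have "dyadic_cube (Suc n) (dyadic_index (Suc n) x) \<subseteq> dyadic_cube n (dyadic_index n x)"
    using dyadic_cube_subset_parent[of n "dyadic_index (Suc n) x"] by (simp add: dyadic_index_parent[of n])
  with step show ?case by blast
qed simp

lemma dyadic_cube_nonempty: "dyadic_cube n k \<noteq> {}"
proof -
  have "(\<chi> i. (of_int (k i) + 1) / 2 ^ n) \<in> dyadic_cube n k"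
    by (auto simp: dyadic_cube_def divide_strict_right_mono)
  then show ?thesis by blast
qed

lemma inj_dyadic_cube: "inj (dyadic_cube n)"
proof
  fix k l assume *: "dyadic_cube n k = dyadic_cube n l"
  obtain x where x: "x \<in> dyadic_cube n k" using dyadic_cube_nonempty by blast
  with * have "x \<in> dyadic_cube n l" by simp
  with x show "k = l" by (simp add: mem_dyadic_cube_iff)
qed

lemma disjoint_dyadic_cube: "k \<noteq> l \<Longrightarrow> dyadic_cube n k \<inter> dyadic_cube n l = {}"
  by (auto simp: mem_dyadic_cube_iff)

lemma dyadic_cube_0_0: "dyadic_cube 0 (\<lambda>_. 0) = half_open_unit_cube"
  by (auto simp: dyadic_cube_def half_open_unit_cube_def)

lemma sets_dyadic_cube[measurable]: "dyadic_cube n k \<in> sets borel"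
  unfolding dyadic_cube_def by measurable

lemma countable_dyadic_cubes: "countable (dyadic_cubes :: (real^'d::finite) set set)"
  unfolding dyadic_cubes_def dyadic_level_def by auto

lemma sets_dyadic_cubes: "Q \<in> dyadic_cubes \<Longrightarrow> Q \<in> sets borel"
  by (auto simp: dyadic_cubes_def dyadic_level_def)

text \<open>The cube lies between the open and the closed box with the same corners, and these have
  equal volume.\<close>

lemma measure_lborel_dyadic_cube:
  "measure lborel (dyadic_cube n k :: (real^'d::finite) set) = (1 / 2 ^ n) ^ CARD('d)"
proof -
  define l u :: "real^'d" where "l = (\<chi> i. of_int (k i) / 2 ^ n)"
    and "u = (\<chi> i. (of_int (k i) + 1) / 2 ^ n)"
  have le: "l $ i \<le> u $ i" for i by (simp add: l_def u_def divide_right_mono)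
  have ne: "cbox l u \<noteq> {}" using le by (auto simp: interval_ne_empty_cart)
  have c: "measure lborel (cbox l u) = (1 / 2 ^ n) ^ CARD('d)"
    using content_cbox_cart[OF ne] by (simp add: l_def u_def diff_divide_distrib[symmetric])
  have b: "emeasure lborel (box l u) = emeasure lborel (cbox l u)"
    by (simp add: emeasure_lborel_box_eq emeasure_lborel_cbox_eq)
  have "box l u \<subseteq> dyadic_cube n k" "dyadic_cube n k \<subseteq> cbox l u"
    by (auto simp: dyadic_cube_def mem_box_cart l_def u_def less_imp_le)
  then have "emeasure lborel (dyadic_cube n k) = emeasure lborel (cbox l u)"
    by (intro antisym) (metis emeasure_mono sets_lborel sets_dyadic_cube borel_closed closed_cbox b)+
  then show ?thesis using c by (simp add: measure_def)
qed

lemma cube_weight_dyadic_cube: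
  fixes \<nu> :: "(real^'d::finite) measure"
  shows "cube_weight \<nu> r (dyadic_cube n k) = measure \<nu> (dyadic_cube n k) * 2 powr (- (real n * r))"
proof -
  have "((1 / 2 ^ n) ^ CARD('d)) powr (r / real CARD('d)) = 2 powr (- (real n * r))"
    using zero_less_card_finite[where 'a = "'d"]
    by (simp add: powr_realpow[symmetric] powr_powr powr_minus_divide[symmetric] powr_divide flip: power_mult)
  then show ?thesis
    by (simp add: cube_weight_def measure_lborel_dyadic_cube)
qed

text \<open>Bounding the norm by the sum of the coordinates gives the factor d instead of its square
  root, which affects only constants.\<close>

lemma dist_dyadic_cube_le:
  fixes x y :: "real^'d::finite"
  assumes "x \<in> dyadic_cube n k" "y \<in> dyadic_cube n k"
  shows "dist x y \<le> real CARD('d) / 2 ^ n"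
proof -
  have "\<bar>(x - y) $ i\<bar> \<le> 1 / 2 ^ n" for i
  proof -
    have "of_int (k i) / 2 ^ n < x $ i" "x $ i \<le> of_int (k i) / 2 ^ n + 1 / 2 ^ n"
      "of_int (k i) / 2 ^ n < y $ i" "y $ i \<le> of_int (k i) / 2 ^ n + 1 / 2 ^ n"
      using assms by (auto simp: dyadic_cube_def add_divide_distrib)
    then show ?thesis by (simp add: abs_le_iff)
  qed
  then have "(\<Sum>i\<in>UNIV. \<bar>(x - y) $ i\<bar>) \<le> real CARD('d) * (1 / 2 ^ n)"
    by (intro sum_bounded_above) auto
  with norm_le_l1_cart[of "x - y"] show ?thesis by (simp add: dist_norm)
qed

text \<open>Indices that differ by two or more in one coordinate leave the width of a whole cube
  between the points in that direction.\<close>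

lemma dist_dyadic_cube_ge:
  fixes x y :: "real^'d::finite"
  assumes "x \<in> dyadic_cube n k" "y \<in> dyadic_cube n l" "\<bar>k i - l i\<bar> \<ge> 2"
  shows "dist x y \<ge> 1 / 2 ^ n"
proof -
  have "real_of_int (k i) < 2 ^ n * x $ i" "2 ^ n * x $ i \<le> of_int (k i) + 1"
      "of_int (l i) < 2 ^ n * y $ i" "2 ^ n * y $ i \<le> of_int (l i) + 1"
    using assms by (auto simp: dyadic_cube_def field_simps)
  moreover have "real_of_int (k i) \<ge> of_int (l i) + 2 \<or> real_of_int (l i) \<ge> of_int (k i) + 2"
    using assms(3) by linarith
  ultimately have "\<bar>2 ^ n * x $ i - 2 ^ n * y $ i\<bar> \<ge> 1"
    by linarith
  also have "2 ^ n * x $ i - 2 ^ n * y $ i = 2 ^ n * (x - y) $ i"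
    by (simp add: algebra_simps)
  finally have "2 ^ n * \<bar>(x - y) $ i\<bar> \<ge> 1"
    by (simp only: abs_mult) simp
  then have "\<bar>(x - y) $ i\<bar> \<ge> 1 / 2 ^ n"
    by (simp add: pos_divide_le_eq mult.commute)
  then show ?thesis
    using component_le_norm_cart[of "x - y" i] by (simp add: dist_norm)
qed

section \<open>Counting children, neighbours and boxes of cube indices\<close>

lemma card_Pi_UNIV:
  fixes A :: "'d::finite \<Rightarrow> 'b set"
  shows "card (Pi UNIV A) = (\<Prod>i\<in>UNIV. card (A i))"
  using card_PiE[of UNIV A] by (simp add: PiE_UNIV_domain)

lemma finite_Pi_UNIV:
  fixes A :: "'d::finite \<Rightarrow> 'b set"
  assumes "\<And>i. finite (A i)"
  shows "finite (Pi UNIV A)"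
  using finite_PiE[of UNIV A] assms by (simp add: PiE_UNIV_domain)

definition dyadic_children :: "('d::finite \<Rightarrow> int) \<Rightarrow> ('d \<Rightarrow> int) set" where
  "dyadic_children l = {k. \<forall>i. k i div 2 = l i}"

lemma dyadic_children_eq: "dyadic_children l = Pi UNIV (\<lambda>i. {2 * l i, 2 * l i + 1})"
  proof -
  have "k i div 2 = l i \<longleftrightarrow> k i \<in> {2 * l i, 2 * l i + 1}" for k i
    by auto
  then show ?thesis by (simp only: dyadic_children_def Pi_def) simp
qed

lemma finite_dyadic_children: "finite (dyadic_children l)"
  and card_dyadic_children: "card (dyadic_children (l :: 'd::finite \<Rightarrow> int)) = 2 ^ CARD('d)"
  by (auto simp: dyadic_children_eq card_Pi_UNIV card_insert_if numeral_2_eq_2 intro!: finite_Pi_UNIV)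

definition dyadic_neighbours :: "('d::finite \<Rightarrow> int) \<Rightarrow> ('d \<Rightarrow> int) set" where
  "dyadic_neighbours l = {k. \<forall>i. \<bar>k i - l i\<bar> \<le> 1}"

lemma dyadic_neighbours_eq: "dyadic_neighbours l = Pi UNIV (\<lambda>i. {l i - 1..l i + 1})"
  by (auto simp: dyadic_neighbours_def Pi_def abs_le_iff algebra_simps)

lemma finite_dyadic_neighbours: "finite (dyadic_neighbours l)"
  and card_dyadic_neighbours: "card (dyadic_neighbours (l :: 'd::finite \<Rightarrow> int)) = 3 ^ CARD('d)"
  by (auto simp: dyadic_neighbours_eq card_Pi_UNIV intro!: finite_Pi_UNIV)

lemma card_int_box_le:
  assumes "\<And>k. k \<in> S \<Longrightarrow> (\<forall>i. \<bar>k i\<bar> \<le> m)" "m \<ge> 0"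
  shows "finite (S :: ('d::finite \<Rightarrow> int) set)" "card S \<le> nat (2 * m + 1) ^ CARD('d)"
proof -
  have *: "S \<subseteq> Pi UNIV (\<lambda>_. {-m..m})" by (intro subsetI Pi_I) (use assms(1) in \<open>auto simp: abs_le_iff minus_le_iff\<close>)
  have fin: "finite (Pi (UNIV :: 'd set) (\<lambda>_. {-m..m}))" by (intro finite_Pi_UNIV) auto
  show "finite S" using * fin finite_subset by blast
  show "card S \<le> nat (2 * m + 1) ^ CARD('d)"
    using card_mono[OF fin *] assms(2) by (simp add: card_Pi_UNIV algebra_simps)
qed

section \<open>Quantization dimension and power laws\<close>

text \<open>The quantifier over e stands inside the eventuality, so the threshold for m does not
  depend on the error. The bound can then be combined with error estimates that hold only for
  infinitely many m.\<close>

lemma quotient_upper_bound: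
  fixes K \<tau> \<epsilon> :: real
  assumes "K > 0" "\<tau> > 0" "\<epsilon> > 0"
  shows "\<forall>\<^sub>F m in sequentially. \<forall>e. 0 \<le> e \<longrightarrow> e \<le> K * real m powr (-\<tau>) \<longrightarrow>
           (if e = 0 then 0 else ln (real m) / (- ln e)) \<le> 1 / \<tau> + \<epsilon>"
proof -
  have "(\<lambda>m::nat. ln (real m) / (\<tau> * ln (real m) - ln K)) \<longlonglongrightarrow> 1 / \<tau>"
    using assms by (simp add: divide_inverse) real_asymp
  then have "\<forall>\<^sub>F m::nat in sequentially. ln (real m) / (\<tau> * ln (real m) - ln K) < 1 / \<tau> + \<epsilon>"
    by (rule order_tendstoD) (use assms in auto)
  moreover have "\<forall>\<^sub>F m::nat in sequentially. \<tau> * ln (real m) - ln K > 0"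
    using assms by real_asymp
  moreover have "\<forall>\<^sub>F m::nat in sequentially. m \<ge> 1"
    by (rule eventually_ge_at_top)
  ultimately show ?thesis
  proof eventually_elim
    case (elim m)
    show ?case
    proof (intro allI impI)
      fix e assume e: "0 \<le> e" "e \<le> K * real m powr (-\<tau>)"
      show "(if e = 0 then 0 else ln (real m) / (- ln e)) \<le> 1 / \<tau> + \<epsilon>"
      proof (cases "e = 0")
        case False
        then have "ln e \<le> ln (K * real m powr (-\<tau>))" using e by simp
        also have "\<dots> = ln K - \<tau> * ln (real m)"
          using elim assms by (simp add: ln_mult ln_powr)
        finally have "ln (real m) / (- ln e) \<le> ln (real m) / (\<tau> * ln (real m) - ln K)"
          using elim by (intro divide_left_mono mult_pos_pos) auto
        with False elim show ?thesis by simp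
      qed (use assms in auto)
    qed
  qed
qed

text \<open>The condition e < 1 makes \<open>- ln e\<close> positive, which bounds the other
  denominator from below; the power bound keeps e away from 0, so the default value of the quotient
  does not occur.\<close>

lemma quotient_lower_bound:
  fixes K \<tau> \<epsilon> :: real
  assumes "K > 0" "\<tau> > 0" "\<epsilon> > 0"
  shows "\<forall>\<^sub>F m in sequentially. \<forall>e. e < 1 \<longrightarrow> K * real m powr (-\<tau>) \<le> e \<longrightarrow>
           1 / \<tau> - \<epsilon> \<le> (if e = 0 then 0 else ln (real m) / (- ln e))"
proof -
  have "(\<lambda>m::nat. ln (real m) / (\<tau> * ln (real m) - ln K)) \<longlonglongrightarrow> 1 / \<tau>"
    using assms by (simp add: divide_inverse) real_asymp
  then have "\<forall>\<^sub>F m::nat in sequentially. ln (real m) / (\<tau> * ln (real m) - ln K) > 1 / \<tau> - \<epsilon>"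
    by (rule order_tendstoD) (use assms in auto)
  moreover have "\<forall>\<^sub>F m::nat in sequentially. m \<ge> 1"
    by (rule eventually_ge_at_top)
  ultimately show ?thesis
  proof eventually_elim
    case (elim m)
    show ?case
    proof (intro allI impI)
      fix e assume e: "e < 1" "K * real m powr (-\<tau>) \<le> e"
      have pos: "K * real m powr (-\<tau>) > 0" using elim assms by simp
      then have e0: "e > 0" using e by linarith
      have "ln K - \<tau> * ln (real m) = ln (K * real m powr (-\<tau>))"
        using elim assms by (simp add: ln_mult ln_powr)
      also have "\<dots> \<le> ln e" using pos e0 e by simp
      finally have le: "- ln e \<le> \<tau> * ln (real m) - ln K" by simp
      have "- ln e > 0" using e0 e by simp
      with le have "ln (real m) / (\<tau> * ln (real m) - ln K) \<le> ln (real m) / (- ln e)"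
        using elim by (intro divide_left_mono mult_pos_pos) auto
      with e0 elim show "1 / \<tau> - \<epsilon> \<le> (if e = 0 then 0 else ln (real m) / (- ln e))" by simp
    qed
  qed
qed

lemma codebook_error_nonneg: "codebook_error \<nu> r \<alpha> \<ge> 0"
  by (simp add: codebook_error_def)

lemma codebooks_nonempty: "m \<ge> 1 \<Longrightarrow> codebooks m \<noteq> {}"
proof -
  assume "m \<ge> 1"
  then have "{0} \<in> codebooks m" by (simp add: codebooks_def)
  then show ?thesis by blast
qed

lemma quantization_error_nonneg: "m \<ge> 1 \<Longrightarrow> quantization_error \<nu> r m \<ge> 0"
  unfolding quantization_error_def
  by (intro cINF_greatest codebooks_nonempty codebook_error_nonneg)

lemma quantization_error_le: "\<alpha> \<in> codebooks m \<Longrightarrow> quantization_error \<nu> r m \<le> codebook_error \<nu> r \<alpha>"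
  unfolding quantization_error_def
  by (rule cINF_lower) (auto intro!: bdd_belowI2[where m = 0] codebook_error_nonneg)

lemma quantization_quotient_upper:
  assumes "K > 0" "\<tau> > 0" "\<epsilon> > 0"
  shows "\<forall>\<^sub>F m in sequentially. quantization_error \<nu> r m \<le> K * real m powr (-\<tau>) \<longrightarrow>
           quantization_quotient \<nu> r m \<le> 1 / \<tau> + \<epsilon>"
  using quotient_upper_bound[OF assms] eventually_ge_at_top[of 1]
  by eventually_elim (simp add: quantization_quotient_def quantization_error_nonneg)

lemma quantization_quotient_lower:
  assumes "K > 0" "\<tau> > 0" "\<epsilon> > 0"
    and "\<forall>\<^sub>F m in sequentially. quantization_error \<nu> r m < 1"
  shows "\<forall>\<^sub>F m in sequentially. K * real m powr (-\<tau>) \<le> quantization_error \<nu> r m \<longrightarrow>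
           1 / \<tau> - \<epsilon> \<le> quantization_quotient \<nu> r m"
  using quotient_lower_bound[OF assms(1-3)] assms(4)
  by eventually_elim (simp add: quantization_quotient_def)

lemma upper_quantization_dim_le:
  assumes "K > 0" "\<tau> > 0"
    and "\<forall>\<^sub>F m in sequentially. quantization_error \<nu> r m \<le> K * real m powr (-\<tau>)"
  shows "upper_quantization_dim \<nu> r \<le> ereal (1 / \<tau>)"
proof (rule ereal_le_epsilon2)
  fix \<epsilon> :: real assume \<epsilon>: "\<epsilon> > 0"
  have "\<forall>\<^sub>F m in sequentially. ereal (quantization_quotient \<nu> r m) \<le> ereal (1 / \<tau>) + ereal \<epsilon>"
    using quantization_quotient_upper[OF assms(1,2) \<epsilon>, of \<nu> r] assms(3) by eventually_elim simp
  then show "upper_quantization_dim \<nu> r \<le> ereal (1 / \<tau>) + ereal \<epsilon>"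
    unfolding upper_quantization_dim_def by (rule Limsup_bounded)
qed

lemma lower_quantization_dim_ge:
  assumes "K > 0" "\<tau> > 0"
    and "\<forall>\<^sub>F m in sequentially. quantization_error \<nu> r m < 1"
    and "\<forall>\<^sub>F m in sequentially. K * real m powr (-\<tau>) \<le> quantization_error \<nu> r m"
  shows "ereal (1 / \<tau>) \<le> lower_quantization_dim \<nu> r"
proof (rule ereal_le_epsilon2)
  fix \<epsilon> :: real assume \<epsilon>: "\<epsilon> > 0"
  have "\<forall>\<^sub>F m in sequentially. ereal (1 / \<tau> - \<epsilon>) \<le> ereal (quantization_quotient \<nu> r m)"
    using quantization_quotient_lower[OF assms(1,2) \<epsilon> assms(3)] assms(4) by eventually_elim simp
  then have "ereal (1 / \<tau> - \<epsilon>) \<le> lower_quantization_dim \<nu> r"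
    unfolding lower_quantization_dim_def by (rule Liminf_bounded)
  then show "ereal (1 / \<tau>) \<le> lower_quantization_dim \<nu> r + ereal \<epsilon>"
    by (cases "lower_quantization_dim \<nu> r") (auto simp: algebra_simps)
qed

lemma Liminf_le_frequently:
  fixes f :: "_ \<Rightarrow> 'a::complete_linorder"
  assumes "\<exists>\<^sub>F x in F. f x \<le> c"
  shows "Liminf F f \<le> c"
proof (rule ccontr)
  assume "\<not> Liminf F f \<le> c"
  then have "\<forall>\<^sub>F x in F. c < f x" using less_LiminfD by (metis not_le)
  with assms show False by (simp add: frequently_def not_le)
qed

lemma Limsup_ge_frequently:
  fixes f :: "_ \<Rightarrow> 'a::complete_linorder"
  assumes "\<exists>\<^sub>F x in F. c \<le> f x"
  shows "c \<le> Limsup F f"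
proof (rule ccontr)
  assume "\<not> c \<le> Limsup F f"
  then have "\<forall>\<^sub>F x in F. f x < c" using Limsup_lessD by (metis not_le)
  with assms show False by (simp add: frequently_def not_le)
qed

lemma lower_quantization_dim_le:
  assumes "K > 0" "\<tau> > 0"
    and "\<exists>\<^sub>F m in sequentially. quantization_error \<nu> r m \<le> K * real m powr (-\<tau>)"
  shows "lower_quantization_dim \<nu> r \<le> ereal (1 / \<tau>)"
proof (rule ereal_le_epsilon2)
  fix \<epsilon> :: real assume \<epsilon>: "\<epsilon> > 0"
  have "\<exists>\<^sub>F m in sequentially. ereal (quantization_quotient \<nu> r m) \<le> ereal (1 / \<tau>) + ereal \<epsilon>"
    using frequently_eventually_frequently[OF assms(3) quantization_quotient_upper[OF assms(1,2) \<epsilon>, of \<nu> r]]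
    by (elim frequently_elim1) simp
  then show "lower_quantization_dim \<nu> r \<le> ereal (1 / \<tau>) + ereal \<epsilon>"
    unfolding lower_quantization_dim_def by (rule Liminf_le_frequently)
qed

lemma upper_quantization_dim_ge:
  assumes "K > 0" "\<tau> > 0"
    and "\<forall>\<^sub>F m in sequentially. quantization_error \<nu> r m < 1"
    and "\<exists>\<^sub>F m in sequentially. K * real m powr (-\<tau>) \<le> quantization_error \<nu> r m"
  shows "ereal (1 / \<tau>) \<le> upper_quantization_dim \<nu> r"
proof (rule ereal_le_epsilon2)
  fix \<epsilon> :: real assume \<epsilon>: "\<epsilon> > 0"
  have "\<exists>\<^sub>F m in sequentially. ereal (1 / \<tau> - \<epsilon>) \<le> ereal (quantization_quotient \<nu> r m)"
    using frequently_eventually_frequently[OF assms(4) quantization_quotient_lower[OF assms(1,2) \<epsilon> assms(3)]]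
    by (elim frequently_elim1) simp
  then have "ereal (1 / \<tau> - \<epsilon>) \<le> upper_quantization_dim \<nu> r"
    unfolding upper_quantization_dim_def by (rule Limsup_ge_frequently)
  then show "ereal (1 / \<tau>) \<le> upper_quantization_dim \<nu> r + ereal \<epsilon>"
    by (cases "upper_quantization_dim \<nu> r") (auto simp: algebra_simps)
qed

lemma lower_quantization_dim_nonneg:
  assumes "\<forall>\<^sub>F m in sequentially. quantization_error \<nu> r m < 1"
  shows "0 \<le> lower_quantization_dim \<nu> r"
  unfolding lower_quantization_dim_def
proof (rule Liminf_bounded)
  show "\<forall>\<^sub>F m in sequentially. 0 \<le> ereal (quantization_quotient \<nu> r m)"
    using assms eventually_ge_at_top[of 1]
  proof eventually_elim
    case (elim m)
    have "ln (quantization_error \<nu> r m) \<le> 0" if "quantization_error \<nu> r m \<noteq> 0"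
      using elim quantization_error_nonneg[of m \<nu> r] that by simp
    with elim show ?case
      by (auto simp: quantization_quotient_def divide_nonneg_nonpos)
  qed
qed

lemma lower_le_upper_quantization_dim: "lower_quantization_dim \<nu> r \<le> upper_quantization_dim \<nu> r"
  unfolding lower_quantization_dim_def upper_quantization_dim_def by (rule Liminf_le_Limsup) simp

lemma frequently_less_Limsup:
  fixes f :: "_ \<Rightarrow> 'a::complete_linorder"
  assumes "c < Limsup F f"
  shows "\<exists>\<^sub>F x in F. c < f x"
proof (rule ccontr)
  assume "\<not> ?thesis"
  then have "\<forall>\<^sub>F x in F. f x \<le> c" by (simp add: not_frequently not_less)
  then have "Limsup F f \<le> c" by (rule Limsup_bounded)
  with assms show False by simp
qed

lemma frequently_Liminf_less:
  fixes f :: "_ \<Rightarrow> 'a::complete_linorder"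
  assumes "Liminf F f < c"
  shows "\<exists>\<^sub>F x in F. f x < c"
proof (rule ccontr)
  assume "\<not> ?thesis"
  then have "\<forall>\<^sub>F x in F. c \<le> f x" by (simp add: not_frequently not_less)
  then have "c \<le> Liminf F f" by (rule Liminf_bounded)
  with assms show False by simp
qed

lemma sum_geometric_le:
  fixes c :: real
  assumes "0 \<le> c" "c < 1" "finite J"
  shows "(\<Sum>j\<in>J. c ^ j) \<le> 1 / (1 - c)"
proof -
  have "(\<Sum>j\<in>J. c ^ j) \<le> (\<Sum>j. c ^ j)"
    using assms by (intro sum_le_suminf) (auto simp: summable_geometric)
  also have "\<dots> = 1 / (1 - c)" using assms by (intro suminf_geometric) auto
  finally show ?thesis .
qed

lemma eventually_ge_powr_at_top:
  fixes a c :: real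
  assumes "a > 0"
  shows "\<forall>\<^sub>F n in sequentially. c \<le> 2 powr (real n * a)"
proof -
  have "filterlim (\<lambda>n. 2 powr (real n * a)) at_top sequentially" using assms by real_asymp
  then show ?thesis by (simp add: filterlim_at_top)
qed

section \<open>Probability measures on a bounded set\<close>

text \<open>Boundedness is required only almost everywhere. In this form it passes directly to
  images under affine maps, so the locale serves both \<nu> and the rescaled measure on which the
  entropy is defined.\<close>

locale bounded_prob = prob_space \<nu> for \<nu> :: "(real^'d::finite) measure" +
  fixes B :: real
  assumes sets_eq[measurable_cong]: "sets \<nu> = sets borel"
    and bounded: "AE x in \<nu>. \<forall>i. \<bar>x $ i\<bar> \<le> B"
begin

definition mass :: "nat \<Rightarrow> ('d \<Rightarrow> int) \<Rightarrow> real" where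
  "mass n k = measure \<nu> (dyadic_cube n k)"

definition weight :: "real \<Rightarrow> nat \<Rightarrow> ('d \<Rightarrow> int) \<Rightarrow> real" where
  "weight r n k = mass n k * 2 powr (- (real n * r))"

definition charged :: "nat \<Rightarrow> ('d \<Rightarrow> int) set" where
  "charged n = {k. mass n k > 0}"

lemma cube_weight_eq: "cube_weight \<nu> r (dyadic_cube n k) = weight r n k"
  by (simp add: weight_def mass_def cube_weight_dyadic_cube)

lemma sets_cube[measurable]: "dyadic_cube n k \<in> sets \<nu>"
  by (simp add: sets_eq sets_dyadic_cube)

lemma mass_nonneg: "mass n k \<ge> 0" and mass_le_1: "mass n k \<le> 1"
  by (simp_all add: mass_def)

lemma weight_nonneg: "weight r n k \<ge> 0"
  by (simp add: weight_def mass_nonneg)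

lemma weight_le: "weight r n k \<le> 2 powr (- (real n * r))"
  unfolding weight_def by (intro mult_left_le_one_le mass_nonneg mass_le_1) auto

lemma weight_le_1: "r > 0 \<Longrightarrow> weight r n k \<le> 1"
  using weight_le[of r n k] powr_mono[of "- (real n * r)" 0 2] by simp

lemma weight_pos: "k \<in> charged n \<Longrightarrow> weight r n k > 0"
  by (simp add: weight_def charged_def)

lemma charged_if_weight_ge: "t > 0 \<Longrightarrow> weight r n k \<ge> t \<Longrightarrow> k \<in> charged n"
  using mass_nonneg[of n k] by (cases "mass n k = 0") (auto simp: weight_def charged_def)

lemma weight_powr: "weight r n k powr q = mass n k powr q * 2 powr (- (real n * r * q))"
  by (simp add: weight_def powr_mult powr_powr mass_nonneg)

text \<open>Along the nested cubes around x both the mass and the factor 2^(-n r) decrease. This is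
  why stopping at the first small weight selects disjoint cubes.\<close>

lemma weight_antimono:
  assumes "m \<le> n" "r > 0"
  shows "weight r n (dyadic_index n x) \<le> weight r m (dyadic_index m x)"
  unfolding weight_def mass_def
proof (intro mult_mono)
  show "measure \<nu> (dyadic_cube n (dyadic_index n x)) \<le> measure \<nu> (dyadic_cube m (dyadic_index m x))"
    by (intro finite_measure_mono dyadic_cube_nested assms) auto
qed (use assms in auto)

text \<open>There are only countably many pairs of a level and an index, so the union of all
  uncharged cubes is a null set.\<close>

lemma AE_charged: "AE x in \<nu>. \<forall>n. dyadic_index n x \<in> charged n"
proof -
  have "AE x in \<nu>. \<not> (dyadic_index n x = k \<and> k \<notin> charged n)" for n k
  proof (cases "k \<in> charged n")
    case False
    then have "mass n k = 0" using mass_nonneg[of n k] by (simp add: charged_def)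
    then have "AE x in \<nu>. x \<notin> dyadic_cube n k"
      by (simp add: mass_def AE_iff_measurable[OF sets_cube] emeasure_eq_measure prob_eq_0)
    then show ?thesis by eventually_elim (simp add: mem_dyadic_cube_iff)
  qed simp
  then have "AE x in \<nu>. \<forall>n. \<forall>k::'d \<Rightarrow> int. \<not> (dyadic_index n x = k \<and> k \<notin> charged n)"
    by (intro AE_all_countable[THEN iffD2] allI)
  then show ?thesis by eventually_elim auto
qed

text \<open>A cube of positive mass contains a point with coordinates bounded by B; the summand 1
  pays for the shift in \<open>dyadic_index\<close>.\<close>

lemma charged_bound:
  assumes "k \<in> charged n"
  shows "\<bar>k i\<bar> \<le> \<lceil>2 ^ n * B\<rceil> + 1"
proof -
  have "\<exists>x \<in> dyadic_cube n k. \<forall>i. \<bar>x $ i\<bar> \<le> B"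
  proof (rule ccontr)
    assume "\<not> ?thesis"
    with bounded have "AE x in \<nu>. x \<notin> dyadic_cube n k" by (auto elim!: eventually_mono)
    then have "mass n k = 0" by (simp add: mass_def prob_eq_0)
    with assms show False by (simp add: charged_def)
  qed
  then obtain x where x: "dyadic_index n x = k" "\<bar>x $ i\<bar> \<le> B"
    by (auto simp: mem_dyadic_cube_iff)
  then have k: "k i = \<lceil>2 ^ n * x $ i\<rceil> - 1" by (auto simp: dyadic_index_def)
  have "2 ^ n * x $ i \<le> 2 ^ n * B" "- (2 ^ n * B) \<le> 2 ^ n * x $ i"
    using x(2) mult_left_mono[of "- B" "x $ i" "2 ^ n"] by (auto simp: abs_le_iff)
  then show ?thesis unfolding k by linarith
qed

lemma B_nonneg: "B \<ge> 0"
proof (rule ccontr)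
  assume "\<not> B \<ge> 0"
  then have "AE x in \<nu>. False"
    by (intro eventually_mono[OF bounded]) (metis abs_ge_zero order_trans)
  then show False by simp
qed

text \<open>By \<open>charged_bound\<close> each coordinate takes at most 2 (ceiling of 2^n B + 1) +
  1 values. This is at most 2 B 2^n + 5, hence at most (2 B + 5) 2^n.\<close>

lemma finite_charged: "finite (charged n)"
  and card_charged: "real (card (charged n)) \<le> ((2 * B + 5) * 2 ^ n) ^ CARD('d)"
proof -
  have nn: "2 ^ n * B \<ge> 0" using B_nonneg by simp
  have *: "\<lceil>2 ^ n * B\<rceil> + 1 \<ge> 0" using nn by linarith
  show "finite (charged n)" using charged_bound card_int_box_le(1)[OF _ *] by blast
  have "card (charged n) \<le> nat (2 * (\<lceil>2 ^ n * B\<rceil> + 1) + 1) ^ CARD('d)"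
    by (rule card_int_box_le(2)) (use charged_bound * in auto)
  then have "real (card (charged n)) \<le> real (nat (2 * (\<lceil>2 ^ n * B\<rceil> + 1) + 1)) ^ CARD('d)"
    by (metis of_nat_le_iff of_nat_power)
  also have "\<dots> \<le> ((2 * B + 5) * 2 ^ n) ^ CARD('d)"
  proof (intro power_mono)
    have "real (nat (2 * (\<lceil>2 ^ n * B\<rceil> + 1) + 1)) = 2 * (of_int \<lceil>2 ^ n * B\<rceil> + 1) + 1"
      using * by simp
    also have "\<dots> \<le> 2 * (2 ^ n * B) + 5"
      using of_int_ceiling_le_add_one[of "2 ^ n * B"] by argo
    also have "\<dots> \<le> (2 * B + 5) * 2 ^ n"
      using one_le_power[of "2::real" n] by (simp add: algebra_simps)
    finally show "real (nat (2 * (\<lceil>2 ^ n * B\<rceil> + 1) + 1)) \<le> (2 * B + 5) * 2 ^ n" .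
  qed simp
  finally show "real (card (charged n)) \<le> ((2 * B + 5) * 2 ^ n) ^ CARD('d)" .
qed

lemma charged_nonempty: "charged n \<noteq> {}"
proof (rule notI)
  assume *: "charged n = {}"
  have "AE x in \<nu>. False"
    using AE_charged by (rule eventually_mono) (use * in blast)
  then show False by simp
qed

lemma sum_mass: "(\<Sum>k\<in>charged n. mass n k) = 1"
proof -
  have "(\<Sum>k\<in>charged n. mass n k) = prob (\<Union>k\<in>charged n. dyadic_cube n k)"
    unfolding mass_def
  proof (rule finite_measure_finite_Union[symmetric])
    show "disjoint_family_on (dyadic_cube n) (charged n)"
      unfolding disjoint_family_on_def by (intro ballI impI disjoint_dyadic_cube)
  qed (simp_all add: finite_charged image_subset_iff sets_cube)
  also have "\<dots> = 1"
  proof (subst prob_eq_1)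
    show "AE x in \<nu>. x \<in> (\<Union>k\<in>charged n. dyadic_cube n k)"
      by (intro eventually_mono[OF AE_charged]) (use mem_dyadic_cube_self in blast)
    show "(\<Union>k\<in>charged n. dyadic_cube n k) \<in> sets \<nu>"
      using finite_charged by (intro sets.finite_UN) (simp_all add: sets_cube)
  qed
  finally show ?thesis .
qed

section \<open>Error bounds from families of dyadic cubes\<close>

lemma measurable_infdist[measurable]: "(\<lambda>x. infdist x \<alpha>) \<in> borel_measurable \<nu>"
  unfolding measurable_cong_sets[OF sets_eq refl]
  by (intro borel_measurable_continuous_onI continuous_on_infdist continuous_on_id)

lemma AE_infdist_le: "\<exists>D \<ge> 0. AE x in \<nu>. infdist x (\<alpha> :: (real^'d) set) \<le> D"
proof (cases "\<alpha> = {}")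
  case False
  then obtain a where a: "a \<in> \<alpha>" by blast
  have "AE x in \<nu>. infdist x \<alpha> \<le> real CARD('d) * B + norm a"
    using bounded
  proof eventually_elim
    case (elim x)
    have "norm x \<le> (\<Sum>i\<in>UNIV. \<bar>x $ i\<bar>)" by (rule norm_le_l1_cart)
    also have "\<dots> \<le> real CARD('d) * B" using elim by (intro sum_bounded_above) auto
    finally have "norm x \<le> real CARD('d) * B" .
    moreover have "infdist x \<alpha> \<le> dist x a" by (rule infdist_le[OF a])
    moreover have "dist x a \<le> norm x + norm a" by (simp add: dist_norm norm_triangle_ineq4)
    ultimately show ?case by linarith
  qed
  then show ?thesis using B_nonneg by (intro exI[of _ "real CARD('d) * B + norm a"]) auto
qed (auto simp: infdist_def)

lemma integrable_infdist_powr: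
  assumes "r \<ge> 0"
  shows "integrable \<nu> (\<lambda>x. infdist x \<alpha> powr r)"
proof -
  obtain D where "AE x in \<nu>. infdist x \<alpha> \<le> D" using AE_infdist_le by blast
  then have "AE x in \<nu>. norm (infdist x \<alpha> powr r) \<le> D powr r"
    by eventually_elim (auto intro!: powr_mono2 infdist_nonneg assms)
  then show ?thesis by (rule integrable_const_bound) measurable
qed

text \<open>One point from each cube forms the codebook. The step function \<open>f\<close> adds up
  the r-th powers of the diameter bounds over the cubes containing x, so overlaps only increase it,
  and its integral is d^r times the sum of the weights.\<close>

lemma quantization_error_upper:
  assumes r: "r > 0" and P: "finite P" "P \<subseteq> dyadic_cubes" and cov: "AE x in \<nu>. x \<in> \<Union>P"
    and t: "\<And>Q. Q \<in> P \<Longrightarrow> cube_weight \<nu> r Q \<le> t" and m: "card P \<le> m"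
  shows "quantization_error \<nu> r m \<le> (real CARD('d) powr r * (real (card P) * t)) powr (1 / r)"
proof -
  have "\<forall>Q\<in>P. \<exists>n k. Q = dyadic_cube n k"
    using P(2) unfolding dyadic_cubes_def dyadic_level_def by blast
  then obtain N K where NK: "\<And>Q. Q \<in> P \<Longrightarrow> Q = dyadic_cube (N Q) (K Q)"
    by metis
  define c where "c Q = (SOME x. x \<in> Q)" for Q :: "(real^'d) set"
  have c: "c Q \<in> Q" if "Q \<in> P" for Q
    unfolding c_def using NK[OF that] dyadic_cube_nonempty by (metis some_in_eq)
  have ne: "P \<noteq> {}"
  proof
    assume "P = {}"
    with cov have "AE x in \<nu>. False" by simp
    then show False by simp
  qed
  define \<alpha> where "\<alpha> = c ` P"
  have "card \<alpha> \<le> card P" "card \<alpha> \<ge> 1"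
    using card_image_le[OF P(1), of c] ne P(1) by (auto simp: \<alpha>_def Suc_le_eq card_gt_0_iff)
  then have \<alpha>: "\<alpha> \<in> codebooks m" using m P(1) by (auto simp: codebooks_def \<alpha>_def)
  define f where "f x = (\<Sum>Q\<in>P. indicator Q x * (real CARD('d) / 2 ^ N Q) powr r)" for x :: "real^'d"
  have Qsets[measurable]: "Q \<in> sets \<nu>" if "Q \<in> P" for Q
    using that P(2) sets_dyadic_cubes sets_eq by blast
  have f_int: "integrable \<nu> f"
    unfolding f_def using Qsets by (intro Bochner_Integration.integrable_sum) (auto simp: less_top[symmetric])
  have pw: "(real CARD('d) / 2 ^ n) powr r = real CARD('d) powr r * 2 powr (- (real n * r))" for n
    by (simp add: powr_divide powr_powr powr_minus_divide flip: powr_realpow)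
  have "integral\<^sup>L \<nu> f = (\<Sum>Q\<in>P. measure \<nu> Q * (real CARD('d) / 2 ^ N Q) powr r)"
    unfolding f_def using Qsets
    by (subst Bochner_Integration.integral_sum) (auto simp: less_top[symmetric] intro!: sum.cong)
  also have "\<dots> = (\<Sum>Q\<in>P. real CARD('d) powr r * cube_weight \<nu> r Q)"
  proof (intro sum.cong refl)
    fix Q assume "Q \<in> P"
    then have "cube_weight \<nu> r Q = measure \<nu> Q * 2 powr (- (real (N Q) * r))"
      using cube_weight_dyadic_cube[of \<nu> r "N Q" "K Q"] NK by metis
    then show "measure \<nu> Q * (real CARD('d) / 2 ^ N Q) powr r = real CARD('d) powr r * cube_weight \<nu> r Q"
      by (simp add: pw)
  qed
  also have "\<dots> \<le> (\<Sum>Q\<in>P. real CARD('d) powr r * t)"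
    by (intro sum_mono mult_left_mono t) auto
  finally have int_f: "integral\<^sup>L \<nu> f \<le> real CARD('d) powr r * (real (card P) * t)"
    by (simp add: mult.left_commute)
  have "AE x in \<nu>. infdist x \<alpha> powr r \<le> f x"
    using cov
  proof eventually_elim
    case (elim x)
    then obtain Q where Q: "Q \<in> P" "x \<in> Q" by blast
    have "infdist x \<alpha> \<le> dist x (c Q)" using Q by (intro infdist_le) (auto simp: \<alpha>_def)
    also have "\<dots> \<le> real CARD('d) / 2 ^ N Q"
      using dist_dyadic_cube_le[of x "N Q" "K Q" "c Q"] c[OF Q(1)] Q NK by metis
    finally have "infdist x \<alpha> powr r \<le> indicator Q x * (real CARD('d) / 2 ^ N Q) powr r"
      using Q r by (simp add: powr_mono2 infdist_nonneg)
    also have "\<dots> \<le> f x"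
      unfolding f_def by (rule member_le_sum) (use Q P in auto)
    finally show ?case .
  qed
  then have "(\<integral>x. infdist x \<alpha> powr r \<partial>\<nu>) \<le> integral\<^sup>L \<nu> f"
    using r by (intro integral_mono_AE integrable_infdist_powr f_int) auto
  also note int_f
  finally have "codebook_error \<nu> r \<alpha> \<le> (real CARD('d) powr r * (real (card P) * t)) powr (1 / r)"
    using r by (auto simp: codebook_error_def intro!: powr_mono2)
  then show ?thesis using quantization_error_le[OF \<alpha>, of \<nu> r] by linarith
qed

text \<open>A codebook point is closer than \<open>2\<^sup>-\<^sup>n\<close> to at most \<open>3\<^sup>d\<close> cubes of level \<open>n\<close>.\<close>

lemma quantization_error_lower:
  assumes r: "r > 0" and G: "finite G" "\<And>k. k \<in> G \<Longrightarrow> t \<le> weight r n k" and t: "t \<ge> 0"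
    and m: "m \<ge> 1" "2 * 3 ^ CARD('d) * m \<le> card G"
  shows "(t * real (card G) / 2) powr (1 / r) \<le> quantization_error \<nu> r m"
  unfolding quantization_error_def
proof (intro cINF_greatest codebooks_nonempty m(1))
  fix \<alpha> :: "(real^'d) set" assume "\<alpha> \<in> codebooks m"
  then have \<alpha>: "finite \<alpha>" "card \<alpha> \<ge> 1" "card \<alpha> \<le> m" by (auto simp: codebooks_def)
  then have ne: "\<alpha> \<noteq> {}" by auto
  \<comment> \<open>Indices of cubes that may be close to the codebook. There are at most m 3^d of
    them, at most half of \<open>card G\<close>.\<close>
  define N where "N = (\<Union>y\<in>\<alpha>. dyadic_neighbours (dyadic_index n y))"
  have "card N \<le> (\<Sum>y\<in>\<alpha>. card (dyadic_neighbours (dyadic_index n y)))"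
    unfolding N_def by (rule card_UN_le[OF \<alpha>(1)])
  also have "\<dots> = card \<alpha> * 3 ^ CARD('d)" by (simp add: card_dyadic_neighbours)
  also have "\<dots> \<le> m * 3 ^ CARD('d)" using \<alpha> by simp
  finally have "2 * card N \<le> card G" using m by (simp add: mult.commute mult.left_commute)
  moreover have "card G \<le> card (G - N) + card N"
    using diff_card_le_card_Diff[of N G] \<alpha> by (simp add: N_def finite_dyadic_neighbours)
  ultimately have half: "real (card G) / 2 \<le> real (card (G - N))" by linarith
  \<comment> \<open>A lower bound for the r-th power of the distance: points of a cube outside N are
    at distance at least 2^(-n) from every codebook point.\<close>
  define f where "f x = (\<Sum>k\<in>G - N. indicator (dyadic_cube n k) x * 2 powr (- (real n * r)))" for x :: "real^'d"
  have f_int: "integrable \<nu> f"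
    unfolding f_def by (intro Bochner_Integration.integrable_sum) (auto simp: less_top[symmetric])
  have "f x \<le> infdist x \<alpha> powr r" for x
  proof (cases "\<exists>k\<in>G - N. x \<in> dyadic_cube n k")
    case True
    then obtain k where k: "k \<in> G - N" "x \<in> dyadic_cube n k" by blast
    \<comment> \<open>Cubes of one level are disjoint, so a single summand survives.\<close>
    have "f x = (\<Sum>l\<in>G - N. if l = k then 2 powr (- (real n * r)) else 0)"
      unfolding f_def using k by (intro sum.cong refl) (auto simp: mem_dyadic_cube_iff indicator_def)
    also have "\<dots> = (1 / 2 ^ n) powr r"
      using k G(1) by (simp add: powr_divide powr_powr powr_minus_divide flip: powr_realpow)
    also have "\<dots> \<le> infdist x \<alpha> powr r"
    proof (intro powr_mono2)
      show "1 / 2 ^ n \<le> infdist x \<alpha>"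
        unfolding infdist_notempty[OF ne]
      proof (intro cINF_greatest ne)
        fix y assume "y \<in> \<alpha>"
        with k have "k \<notin> dyadic_neighbours (dyadic_index n y)" by (auto simp: N_def)
        then obtain i where "\<not> \<bar>k i - dyadic_index n y i\<bar> \<le> 1"
          by (auto simp: dyadic_neighbours_def)
        then have "\<bar>k i - dyadic_index n y i\<bar> \<ge> 2" by linarith
        then show "1 / 2 ^ n \<le> dist x y"
          by (rule dist_dyadic_cube_ge[OF k(2) mem_dyadic_cube_self])
      qed
    qed (use r in auto)
    finally show ?thesis .
  next
    case False
    then have "f x = 0" unfolding f_def by (intro sum.neutral) auto
    then show ?thesis by simp
  qed
  then have le: "integral\<^sup>L \<nu> f \<le> (\<integral>x. infdist x \<alpha> powr r \<partial>\<nu>)"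
    using r by (intro integral_mono integrable_infdist_powr f_int) auto
  have "t * real (card G) / 2 \<le> real (card (G - N)) * t"
    using mult_left_mono[OF half t] by (simp add: mult.commute)
  also have "\<dots> \<le> (\<Sum>k\<in>G - N. weight r n k)"
    using G by (intro sum_bounded_below) auto
  also have "\<dots> = integral\<^sup>L \<nu> f"
    unfolding f_def
    by (subst Bochner_Integration.integral_sum)
       (auto simp: less_top[symmetric] weight_def mass_def intro!: sum.cong)
  also note le
  finally have "(t * real (card G) / 2) powr (1 / r) \<le> (\<integral>x. infdist x \<alpha> powr r \<partial>\<nu>) powr (1 / r)"
    using r t by (intro powr_mono2) auto
  then show "(t * real (card G) / 2) powr (1 / r) \<le> codebook_error \<nu> r \<alpha>"
    using r by (simp add: codebook_error_def)
qed

section \<open>The \<open>L\<^sup>q\<close>-spectrum\<close>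

text \<open>The restriction to charged cubes makes the sum finite and realises the convention that 0
  to the power 0 is 0: at q = 0 the charged cubes are counted.\<close>

definition power_sum :: "nat \<Rightarrow> real \<Rightarrow> real" where
  "power_sum n q = (\<Sum>k\<in>charged n. mass n k powr q)"

lemma Lq_spectrum_level_eq: "Lq_spectrum_level \<nu> n q = ln (power_sum n q) / (real n * ln 2)"
proof -
  have "(\<Sum>\<^sub>\<infinity>C\<in>dyadic_level n. measure \<nu> C powr q) = (\<Sum>\<^sub>\<infinity>k\<in>UNIV. mass n k powr q)"
    unfolding dyadic_level_def mass_def using infsum_reindex[OF inj_dyadic_cube] by (simp add: o_def)
  also have "\<dots> = (\<Sum>\<^sub>\<infinity>k\<in>charged n. mass n k powr q)"
  proof (rule infsum_cong_neutral)
    fix k assume "k \<in> UNIV - charged n"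
    then have "mass n k = 0" using mass_nonneg[of n k] by (simp add: charged_def)
    then show "mass n k powr q = 0" by simp
  qed auto
  also have "\<dots> = power_sum n q"
    by (simp add: power_sum_def finite_charged)
  finally show ?thesis
    by (simp add: Lq_spectrum_level_def ln_realpow)
qed

lemma power_sum_pos: "power_sum n q > 0"
  unfolding power_sum_def
  by (rule sum_pos) (auto simp: finite_charged charged_nonempty, auto simp: charged_def)

lemma power_sum_1: "power_sum n 1 = 1"
  using sum_mass by (simp add: power_sum_def mass_nonneg)

lemma power_sum_antimono: "a \<le> b \<Longrightarrow> power_sum n b \<le> power_sum n a"
  unfolding power_sum_def
  by (intro sum_mono powr_mono') (auto simp: mass_nonneg mass_le_1)

text \<open>Hoelder's inequality. Young's inequality is applied to each term after division by the
  sums A and C; the normalised terms then add up to (1 - u) + u = 1.\<close>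

lemma power_sum_log_convex:
  assumes "0 \<le> u" "u \<le> 1"
  shows "power_sum n ((1 - u) * a + u * b) \<le> power_sum n a powr (1 - u) * power_sum n b powr u"
proof -
  define A C where "A = power_sum n a" and "C = power_sum n b"
  have pos: "A > 0" "C > 0" by (simp_all add: A_def C_def power_sum_pos)
  have "mass n k powr ((1 - u) * a + u * b)
      \<le> A powr (1 - u) * C powr u * ((1 - u) * (mass n k powr a / A) + u * (mass n k powr b / C))"
    if "k \<in> charged n" for k
  proof -
    from that have k: "mass n k > 0" by (simp add: charged_def)
    have "mass n k powr ((1 - u) * a + u * b)
        = A powr (1 - u) * C powr u * ((mass n k powr a / A) powr (1 - u) * (mass n k powr b / C) powr u)"
      using pos k by (simp add: powr_divide powr_powr powr_add mult.commute)
    also have "\<dots> \<le> A powr (1 - u) * C powr u * ((1 - u) * (mass n k powr a / A) + u * (mass n k powr b / C))"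
      using pos k assms by (intro mult_left_mono Youngs_inequality_0) auto
    finally show ?thesis .
  qed
  then have "power_sum n ((1 - u) * a + u * b)
      \<le> (\<Sum>k\<in>charged n. A powr (1 - u) * C powr u * ((1 - u) * (mass n k powr a / A) + u * (mass n k powr b / C)))"
    unfolding power_sum_def[of n "(1 - u) * a + u * b"] by (rule sum_mono)
  also have "\<dots> = A powr (1 - u) * C powr u * ((1 - u) * (A / A) + u * (C / C))"
    by (simp only: A_def C_def power_sum_def sum_distrib_left[symmetric] sum.distrib sum_divide_distrib[symmetric])
  also have "\<dots> = A powr (1 - u) * C powr u" using pos by simp
  finally show ?thesis by (simp add: A_def C_def)
qed

lemma level_antimono: "a \<le> b \<Longrightarrow> Lq_spectrum_level \<nu> n b \<le> Lq_spectrum_level \<nu> n a"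
  unfolding Lq_spectrum_level_eq
  by (intro divide_right_mono) (auto simp: power_sum_pos power_sum_antimono)

lemma level_nonneg: "q \<le> 1 \<Longrightarrow> Lq_spectrum_level \<nu> n q \<ge> 0"
  using power_sum_antimono[of q 1 n] by (simp add: Lq_spectrum_level_eq power_sum_1)

lemma level_convex:
  assumes "0 \<le> u" "u \<le> 1"
  shows "Lq_spectrum_level \<nu> n ((1 - u) * a + u * b)
    \<le> (1 - u) * Lq_spectrum_level \<nu> n a + u * Lq_spectrum_level \<nu> n b"
proof -
  have "ln (power_sum n ((1 - u) * a + u * b)) \<le> ln (power_sum n a powr (1 - u) * power_sum n b powr u)"
    by (intro ln_mono power_sum_log_convex assms power_sum_pos)
  also have "\<dots> = (1 - u) * ln (power_sum n a) + u * ln (power_sum n b)"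
    using power_sum_pos[of n a] power_sum_pos[of n b] by (simp add: ln_mult ln_powr)
  finally have "ln (power_sum n ((1 - u) * a + u * b)) / (real n * ln 2)
      \<le> ((1 - u) * ln (power_sum n a) + u * ln (power_sum n b)) / (real n * ln 2)"
    by (rule divide_right_mono) simp
  then show ?thesis
    by (simp add: Lq_spectrum_level_eq add_divide_distrib)
qed

text \<open>Convexity between 0 and 1: at 1 the level spectrum vanishes because the masses add up to
  1, and at 0 it is bounded by the number of charged cubes.\<close>

lemma level_upper:
  assumes "n \<ge> 1" "0 \<le> q" "q \<le> 1"
  shows "Lq_spectrum_level \<nu> n q \<le> (1 - q) * (real CARD('d) * (ln (2 * B + 5) / (real n * ln 2) + 1))"
proof -
  have "power_sum n 0 = real (card (charged n))"
    unfolding power_sum_def by (simp add: charged_def)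
  also have "\<dots> \<le> ((2 * B + 5) * 2 ^ n) ^ CARD('d)" by (rule card_charged)
  finally have "ln (power_sum n 0) \<le> ln (((2 * B + 5) * 2 ^ n) ^ CARD('d))"
    by (intro ln_mono power_sum_pos)
  also have "\<dots> = real CARD('d) * (ln (2 * B + 5) + real n * ln 2)"
    using B_nonneg by (simp add: ln_realpow ln_mult)
  finally have "Lq_spectrum_level \<nu> n 0 \<le> real CARD('d) * (ln (2 * B + 5) + real n * ln 2) / (real n * ln 2)"
    unfolding Lq_spectrum_level_eq by (intro divide_right_mono) auto
  also have "\<dots> = real CARD('d) * (ln (2 * B + 5) / (real n * ln 2) + 1)"
    using assms(1) by (simp add: field_simps)
  finally have *: "Lq_spectrum_level \<nu> n 0 \<le> real CARD('d) * (ln (2 * B + 5) / (real n * ln 2) + 1)" .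
  have "Lq_spectrum_level \<nu> n q \<le> (1 - q) * Lq_spectrum_level \<nu> n 0"
    using level_convex[of q n 0 1] assms by (simp add: Lq_spectrum_level_eq power_sum_1)
  also have "\<dots> \<le> (1 - q) * (real CARD('d) * (ln (2 * B + 5) / (real n * ln 2) + 1))"
    using assms * by (intro mult_left_mono) auto
  finally show ?thesis .
qed

lemma Lq_spectrum_antimono: "a \<le> b \<Longrightarrow> Lq_spectrum \<nu> b \<le> Lq_spectrum \<nu> a"
  unfolding Lq_spectrum_def by (intro Limsup_mono) (simp add: level_antimono)

lemma Lq_spectrum_nonneg: "q \<le> 1 \<Longrightarrow> Lq_spectrum \<nu> q \<ge> 0"
  unfolding Lq_spectrum_def
  by (intro order_trans[OF _ Liminf_le_Limsup] Liminf_bounded) (simp_all add: level_nonneg)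

lemma Lq_spectrum_upper:
  assumes "0 \<le> q" "q \<le> 1"
  shows "Lq_spectrum \<nu> q \<le> ereal ((1 - q) * real CARD('d))"
proof -
  have "(\<lambda>n. (1 - q) * (real CARD('d) * (ln (2 * B + 5) / (real n * ln 2) + 1)))
      \<longlonglongrightarrow> (1 - q) * (real CARD('d) * (0 + 1))"
    by (intro tendsto_intros) real_asymp
  then have lim: "(\<lambda>n. ereal ((1 - q) * (real CARD('d) * (ln (2 * B + 5) / (real n * ln 2) + 1))))
      \<longlonglongrightarrow> ereal ((1 - q) * real CARD('d))"
    by (simp add: tendsto_ereal)
  have "Lq_spectrum \<nu> q
      \<le> limsup (\<lambda>n. ereal ((1 - q) * (real CARD('d) * (ln (2 * B + 5) / (real n * ln 2) + 1))))"
    unfolding Lq_spectrum_def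
    by (intro Limsup_mono eventually_mono[OF eventually_ge_at_top[of 1]]) (simp add: level_upper assms)
  also have "\<dots> = ereal ((1 - q) * real CARD('d))"
    using lim by (intro lim_imp_Limsup) auto
  finally show ?thesis .
qed

text \<open>Meant for arguments in [0, 1], where the spectrum is finite. A real-valued function is
  what \<open>convex_on\<close> and the continuity of convex functions refer to.\<close>

definition beta :: "real \<Rightarrow> real" where
  "beta q = real_of_ereal (Lq_spectrum \<nu> q)"

lemma Lq_spectrum_eq_beta:
  assumes "0 \<le> q" "q \<le> 1"
  shows "Lq_spectrum \<nu> q = ereal (beta q)"
  using Lq_spectrum_nonneg[OF assms(2)] Lq_spectrum_upper[OF assms]
  by (cases "Lq_spectrum \<nu> q") (auto simp: beta_def)

text \<open>Up to e, the bounds at a and b hold at all large levels simultaneously, so convexity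
  survives the limes superior. On an open interval convexity implies continuity.\<close>

lemma convex_beta: "convex_on {0<..<1} beta"
proof (rule convex_onI)
  fix u a b :: real
  assume u: "0 < u" "u < 1" and a: "a \<in> {0<..<1}" and b: "b \<in> {0<..<1}"
  have c: "(1 - u) * a + u * b \<in> {0<..<1}"
    using convexD_alt[of "{0<..<1::real}" a b u] u a b by simp
  have "Lq_spectrum \<nu> ((1 - u) * a + u * b) \<le> ereal ((1 - u) * beta a + u * beta b)"
  proof (rule ereal_le_epsilon2)
    fix e :: real assume e: "e > 0"
    have ev: "\<forall>\<^sub>F n in sequentially. Lq_spectrum_level \<nu> n q < beta q + e" if "q \<in> {0<..<1}" for q
    proof -
      have "Lq_spectrum \<nu> q < ereal (beta q + e)" using Lq_spectrum_eq_beta that e by simp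
      then show ?thesis unfolding Lq_spectrum_def using Limsup_lessD by fastforce
    qed
    have "\<forall>\<^sub>F n in sequentially. ereal (Lq_spectrum_level \<nu> n ((1 - u) * a + u * b))
        \<le> ereal ((1 - u) * beta a + u * beta b + e)"
      using ev[OF a] ev[OF b]
    proof eventually_elim
      case (elim n)
      have "Lq_spectrum_level \<nu> n ((1 - u) * a + u * b)
          \<le> (1 - u) * Lq_spectrum_level \<nu> n a + u * Lq_spectrum_level \<nu> n b"
        using u by (intro level_convex) auto
      also have "\<dots> \<le> (1 - u) * (beta a + e) + u * (beta b + e)"
        using u elim by (intro add_mono mult_left_mono) auto
      finally show ?case by (simp add: algebra_simps)
    qed
    then show "Lq_spectrum \<nu> ((1 - u) * a + u * b) \<le> ereal ((1 - u) * beta a + u * beta b) + ereal e"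
      unfolding Lq_spectrum_def by (simp add: Limsup_bounded)
  qed
  then show "beta ((1 - u) *\<^sub>R a + u *\<^sub>R b) \<le> (1 - u) * beta a + u * beta b"
    using Lq_spectrum_eq_beta[of "(1 - u) * a + u * b"] c by simp
qed simp

section \<open>The critical exponent\<close>

context
  fixes r :: real
  assumes r: "r > 0"
begin

lemma subcritical_exponent_exists: "\<exists>q. 0 < q \<and> q < 1 \<and> Lq_spectrum \<nu> q < ereal (r * q)"
proof -
  define D where "D = real CARD('d)"
  have D: "D > 0" by (simp add: D_def)
  \<comment> \<open>The bound (1 - q) D falls below r q exactly for q > D / (D + r); the choice is
    the midpoint of D / (D + r) and 1.\<close>
  define q where "q = (2 * D + r) / (2 * D + 2 * r)"
  have q: "0 < q" "q < 1" using D r by (auto simp: q_def)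
  have "(1 - q) * D = D * r / (2 * D + 2 * r)" "r * q = (2 * D * r + r * r) / (2 * D + 2 * r)"
    using D r by (auto simp: q_def field_simps)
  moreover have "D * r < 2 * D * r + r * r" using D r by (simp add: pos_add_strict)
  ultimately have "(1 - q) * D < r * q" using D r by (simp add: divide_strict_right_mono)
  then have "Lq_spectrum \<nu> q < ereal (r * q)"
    using Lq_spectrum_upper[of q] q unfolding D_def[symmetric] by (auto intro: le_less_trans)
  with q show ?thesis by blast
qed

lemma bdd_below_exponents: "bdd_below {q. q > 0 \<and> Lq_spectrum \<nu> q < ereal (r * q)}"
  by (rule bdd_belowI[of _ 0]) auto

lemma critical_exponent_less_1: "critical_exponent \<nu> r < 1"
proof -
  obtain q where q: "0 < q" "q < 1" "Lq_spectrum \<nu> q < ereal (r * q)"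
    using subcritical_exponent_exists by blast
  then have "critical_exponent \<nu> r \<le> q"
    unfolding critical_exponent_def by (intro cInf_lower bdd_below_exponents) auto
  with q show ?thesis by simp
qed

lemma critical_exponent_nonneg: "critical_exponent \<nu> r \<ge> 0"
  unfolding critical_exponent_def
  using subcritical_exponent_exists by (intro cInf_greatest) auto

text \<open>The spectrum is decreasing in q and r q is increasing, so the set whose infimum is taken
  is closed upwards.\<close>

lemma spectrum_above_critical:
  assumes "q > critical_exponent \<nu> r"
  shows "Lq_spectrum \<nu> q < ereal (r * q)"
proof -
  obtain p where p: "p > 0" "Lq_spectrum \<nu> p < ereal (r * p)" "p < q"
    using assms subcritical_exponent_exists bdd_below_exponents
    unfolding critical_exponent_def by (subst (asm) cInf_less_iff) auto
  have "Lq_spectrum \<nu> q \<le> Lq_spectrum \<nu> p" using p by (intro Lq_spectrum_antimono) simp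
  also note p(2)
  also have "ereal (r * p) \<le> ereal (r * q)" using p r by simp
  finally show ?thesis .
qed

text \<open>The infimum itself gives only a weak inequality; comparing with an exponent p between q
  and the critical one makes it strict.\<close>

lemma spectrum_below_critical:
  assumes "0 < q" "q < critical_exponent \<nu> r"
  shows "Lq_spectrum \<nu> q > ereal (r * q)"
proof -
  obtain p where p: "q < p" "p < critical_exponent \<nu> r" using dense assms(2) by blast
  have "\<not> Lq_spectrum \<nu> p < ereal (r * p)"
  proof
    assume "Lq_spectrum \<nu> p < ereal (r * p)"
    then have "critical_exponent \<nu> r \<le> p"
      unfolding critical_exponent_def using p assms by (intro cInf_lower bdd_below_exponents) auto
    with p show False by simp
  qed
  then have "ereal (r * p) \<le> Lq_spectrum \<nu> p" by simp
  also have "\<dots> \<le> Lq_spectrum \<nu> q" using p by (intro Lq_spectrum_antimono) simp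
  finally show ?thesis using p r by (auto intro: less_le_trans[rotated])
qed

lemma critical_exponent_pos:
  assumes "(SUP x\<in>{0<..<1}. Lq_spectrum \<nu> x) > 0"
  shows "critical_exponent \<nu> r > 0"
proof (rule ccontr)
  assume "\<not> critical_exponent \<nu> r > 0"
  then have le: "critical_exponent \<nu> r \<le> 0" by simp
  obtain x where x: "0 < x" "x < 1" "Lq_spectrum \<nu> x > 0"
    using assms by (auto simp: less_SUP_iff)
  then have bx: "beta x > 0" using Lq_spectrum_eq_beta[of x] by simp
  \<comment> \<open>By monotonicity the spectrum is at least \<open>beta x\<close> on (0, x], while
    r q tends to 0 with q. This q satisfies both q \<le> x and r q \<le>
    \<open>beta x\<close>.\<close>
  define q where "q = min x (beta x / r)"
  have q: "q > 0" "q \<le> x" "r * q \<le> beta x"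
    using bx x r by (auto simp: q_def min_def field_simps)
  have "ereal (beta x) \<le> Lq_spectrum \<nu> q"
    using Lq_spectrum_antimono[OF q(2)] Lq_spectrum_eq_beta[of x] x by simp
  moreover have "Lq_spectrum \<nu> q < ereal (r * q)"
    using le q by (intro spectrum_above_critical) auto
  ultimately have "ereal (beta x) < ereal (r * q)" by (rule le_less_trans)
  with q show False by simp
qed

text \<open>The inequalities on both sides of p extend to p by continuity of \<open>beta\<close>,
  available because p lies inside (0, 1).\<close>

lemma spectrum_at_critical:
  assumes "critical_exponent \<nu> r > 0"
  shows "Lq_spectrum \<nu> (critical_exponent \<nu> r) = ereal (r * critical_exponent \<nu> r)"
proof -
  define p where "p = critical_exponent \<nu> r"
  have p: "0 < p" "p < 1" using assms critical_exponent_less_1 by (auto simp: p_def)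
  have "isCont beta p"
    using convex_on_continuous[OF _ convex_beta] p by (simp add: continuous_on_eq_continuous_at)
  then have c: "isCont (\<lambda>q. beta q - r * q) p" by (intro continuous_intros)
  have "beta p - r * p \<le> 0"
  proof (rule tendsto_upperbound)
    show "((\<lambda>q. beta q - r * q) \<longlongrightarrow> beta p - r * p) (at_right p)"
      using c by (auto simp: isCont_def filterlim_at_split)
    have "\<forall>\<^sub>F q in at_right p. q \<in> {p<..<1}" using p by (intro eventually_at_right_real)
    then show "\<forall>\<^sub>F q in at_right p. beta q - r * q \<le> 0"
    proof eventually_elim
      case (elim q)
      then show ?case using spectrum_above_critical[of q] Lq_spectrum_eq_beta[of q] p by (simp add: p_def)
    qed
  qed simp
  moreover have "beta p - r * p \<ge> 0"
  proof (rule tendsto_lowerbound)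
    show "((\<lambda>q. beta q - r * q) \<longlongrightarrow> beta p - r * p) (at_left p)"
      using c by (auto simp: isCont_def filterlim_at_split)
    have "\<forall>\<^sub>F q in at_left p. q \<in> {0<..<p}" using p by (intro eventually_at_left_real)
    then show "\<forall>\<^sub>F q in at_left p. beta q - r * q \<ge> 0"
    proof eventually_elim
      case (elim q)
      then show ?case using spectrum_below_critical[of q] Lq_spectrum_eq_beta[of q] p by (simp add: p_def)
    qed
  qed simp
  ultimately show ?thesis using Lq_spectrum_eq_beta[of p] p by (simp add: p_def)
qed

text \<open>The critical exponent is below 1, so the Renyi dimension is the quotient of the spectrum
  by 1 - q there.\<close>

lemma upper_renyi_dim_at_critical:
  assumes "critical_exponent \<nu> r > 0"
  shows "upper_renyi_dim \<nu> (critical_exponent \<nu> r)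
    = ereal (r * critical_exponent \<nu> r / (1 - critical_exponent \<nu> r))"
  using spectrum_at_critical[OF assms] critical_exponent_less_1
  by (simp add: upper_renyi_dim_def)

end

section \<open>Stopping cubes\<close>

text \<open>Since weights decrease along nested cubes, testing the parent suffices to express that n
  is the first level from n0 on with weight below t. The start n0 is kept free because the limes
  superior controls power sums only from some level on.\<close>

definition stopping :: "real \<Rightarrow> nat \<Rightarrow> real \<Rightarrow> (nat \<times> ('d \<Rightarrow> int)) set" where
  "stopping r n0 t = {(n, k). n \<ge> n0 \<and> weight r n k < t \<and>
     (n = n0 \<or> weight r (n - 1) (\<lambda>i. k i div 2) \<ge> t)}"

lemma weight_eventually_less:
  assumes "r > 0" "t > 0"
  shows "\<exists>N. \<forall>n\<ge>N. \<forall>k. weight r n k < t"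
proof -
  have "(\<lambda>n. 2 powr (- (real n * r))) \<longlonglongrightarrow> 0" using assms(1) by real_asymp
  then have "\<forall>\<^sub>F n in sequentially. 2 powr (- (real n * r)) < t"
    using assms(2) by (rule order_tendstoD)
  then obtain N where "\<forall>n\<ge>N. 2 powr (- (real n * r)) < t" by (auto simp: eventually_sequentially)
  then show ?thesis using weight_le[of r] by (meson le_less_trans)
qed

lemma stopping_exists:
  assumes "r > 0" "t > 0"
  obtains n where "(n, dyadic_index n x) \<in> stopping r n0 t"
proof -
  define Q where "Q n \<longleftrightarrow> n \<ge> n0 \<and> weight r n (dyadic_index n x) < t" for n
  obtain N where "\<forall>n\<ge>N. \<forall>k. weight r n k < t" using weight_eventually_less[OF assms] by blast
  then have "Q (max N n0)" by (simp add: Q_def)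
  then have Q: "Q (LEAST n. Q n)" by (rule LeastI)
  define n where "n = (LEAST n. Q n)"
  have "n = n0 \<or> weight r (n - 1) (\<lambda>i. dyadic_index n x i div 2) \<ge> t"
  proof (cases "n = n0")
    case False
    with Q have n: "n > n0" by (simp add: Q_def n_def)
    then have "n = Suc (n - 1)" by simp
    then have e: "(\<lambda>i. dyadic_index n x i div 2) = dyadic_index (n - 1) x"
      using dyadic_index_parent[of "n - 1" x] by metis
    have "\<not> Q (n - 1)" using n not_less_Least[of "n - 1" Q] by (simp add: n_def)
    moreover have "n0 \<le> n - 1" using n by simp
    ultimately show ?thesis by (simp add: Q_def e)
  qed simp
  with Q have "(n, dyadic_index n x) \<in> stopping r n0 t"
    by (simp add: stopping_def Q_def n_def)
  then show ?thesis by (rule that)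
qed

text \<open>If n < m, the parent of the smaller cube has weight at least t but lies inside the
  larger stopping cube, whose weight is below t.\<close>

lemma stopping_unique:
  assumes "r > 0" and "(n, k) \<in> stopping r n0 t" "(m, l) \<in> stopping r n0 t"
    and "x \<in> dyadic_cube n k" "x \<in> dyadic_cube m l"
  shows "n = m \<and> k = l"
proof -
  have False if "(n, k) \<in> stopping r n0 t" "(m, l) \<in> stopping r n0 t"
    "x \<in> dyadic_cube n k" "x \<in> dyadic_cube m l" "n < m" for n m k l
  proof -
    from that have k: "k = dyadic_index n x" and l: "l = dyadic_index m x"
      by (auto simp: mem_dyadic_cube_iff)
    have "m = Suc (m - 1)" using that by simp
    then have e: "(\<lambda>i. l i div 2) = dyadic_index (m - 1) x"
      using dyadic_index_parent[of "m - 1" x] l by metis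
    have "t \<le> weight r (m - 1) (dyadic_index (m - 1) x)"
      using that by (auto simp: stopping_def e)
    also have "\<dots> \<le> weight r n k"
      unfolding k using that assms(1) by (intro weight_antimono) auto
    also have "\<dots> < t" using that by (simp add: stopping_def)
    finally show False by simp
  qed
  then have "n = m" using assms(2-) by (metis linorder_neqE_nat)
  with assms show ?thesis by (simp add: mem_dyadic_cube_iff)
qed

definition charged_stopping :: "real \<Rightarrow> nat \<Rightarrow> real \<Rightarrow> (nat \<times> ('d \<Rightarrow> int)) set" where
  "charged_stopping r n0 t = {(n, k) \<in> stopping r n0 t. k \<in> charged n}"

lemma finite_heavy: "t > 0 \<Longrightarrow> finite {k. weight r n k \<ge> t}"
  using charged_if_weight_ge by (intro finite_subset[OF _ finite_charged]) auto

text \<open>Markov's inequality for the q-th powers of the weights.\<close>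

lemma card_heavy_le:
  assumes "t > 0" "q > 0"
  shows "real (card {k. weight r n k \<ge> t}) \<le> t powr (- q) * (\<Sum>k\<in>charged n. weight r n k powr q)"
proof -
  have "real (card {k. weight r n k \<ge> t}) * t powr q \<le> (\<Sum>k | weight r n k \<ge> t. weight r n k powr q)"
    using assms by (intro sum_bounded_below) (auto intro!: powr_mono2)
  also have "\<dots> \<le> (\<Sum>k\<in>charged n. weight r n k powr q)"
    using charged_if_weight_ge[OF assms(1)] by (intro sum_mono2 finite_charged) auto
  finally show ?thesis using assms by (simp add: powr_minus field_simps)
qed

text \<open>A stopping cube above level n0 is one of the 2^d children of a cube of weight at least
  t. By Markov's inequality the numbers of such parents are bounded by a geometric series times
  t^(-q). The cubes of level n0 are a constant number, absorbed because t^(-q) \<ge> 1 for t \<le>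
  1.\<close>

lemma card_charged_stopping:
  assumes r: "r > 0" and q: "q > 0" and sub: "Lq_spectrum \<nu> q < ereal (r * q)"
  shows "\<exists>n0 K. K > 0 \<and> (\<forall>t. 0 < t \<and> t \<le> 1 \<longrightarrow>
    finite (charged_stopping r n0 t) \<and> real (card (charged_stopping r n0 t)) \<le> K * t powr (- q))"
proof -
  obtain s where s: "Lq_spectrum \<nu> q < ereal s" "s < r * q"
    using ereal_dense2[OF sub] by auto
  \<comment> \<open>If the level spectrum is below s, the sum of the q-th powers of the weights at
    level n is at most 2^(n (s - r q)) = c^n.\<close>
  define c where "c = 2 powr (s - r * q)"
  have c: "0 < c" "c < 1" using s by (auto simp: c_def powr_less_one)
  have "\<forall>\<^sub>F n in sequentially. Lq_spectrum_level \<nu> n q < s"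
    using Limsup_lessD[OF s(1)[unfolded Lq_spectrum_def]] by simp
  then obtain n1 where n1: "\<And>n. n \<ge> n1 \<Longrightarrow> Lq_spectrum_level \<nu> n q < s"
    by (auto simp: eventually_sequentially)
  \<comment> \<open>Level 0 is skipped, as the level spectrum divides by n.\<close>
  define n0 where "n0 = max n1 1"
  have wsum: "(\<Sum>k\<in>charged n. weight r n k powr q) \<le> c ^ n" if "n \<ge> n0" for n
  proof -
    have n: "n \<ge> 1" "n \<ge> n1" using that by (auto simp: n0_def)
    have "ln (power_sum n q) < s * (real n * ln 2)"
      using n1[OF n(2)] n(1) by (simp add: Lq_spectrum_level_eq pos_divide_less_eq)
    then have "ln (power_sum n q) < ln (2 powr (real n * s))" by (simp add: ln_powr mult_ac)
    then have "power_sum n q < 2 powr (real n * s)"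
      by (subst (asm) ln_less_cancel_iff) (auto simp: power_sum_pos)
    then have "power_sum n q * 2 powr (- (real n * r * q)) \<le> 2 powr (real n * s) * 2 powr (- (real n * r * q))"
      by (intro mult_right_mono) auto
    also have "\<dots> = 2 powr ((s - r * q) * real n)" by (simp add: algebra_simps flip: powr_add)
    also have "\<dots> = c ^ n" by (simp add: c_def powr_powr flip: powr_realpow)
    finally show ?thesis by (simp add: weight_powr power_sum_def sum_distrib_right)
  qed
  define H where "H t = (SIGMA n:{n0..}. {k. weight r n k \<ge> t})" for t
  have H: "finite (H t) \<and> real (card (H t)) \<le> t powr (- q) / (1 - c)" if t: "t > 0" for t
  proof -
    \<comment> \<open>Weights at level n are at most 2^(-n r), so only finitely many levels contain
      a cube of weight at least t.\<close>
    obtain N where N: "\<forall>n\<ge>N. \<forall>k. weight r n k < t" using weight_eventually_less[OF r t] by blast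
    have eq: "H t = (SIGMA n:{n0..<N}. {k. weight r n k \<ge> t})"
      using N by (force simp: H_def not_le[symmetric])
    have "real (card (H t)) = (\<Sum>n\<in>{n0..<N}. real (card {k. weight r n k \<ge> t}))"
      unfolding eq using t by (subst card_SigmaI) (auto simp: finite_heavy)
    also have "\<dots> \<le> (\<Sum>n\<in>{n0..<N}. t powr (- q) * c ^ n)"
    proof (intro sum_mono)
      fix n assume "n \<in> {n0..<N}"
      then have "t powr (- q) * (\<Sum>k\<in>charged n. weight r n k powr q) \<le> t powr (- q) * c ^ n"
        by (intro mult_left_mono wsum) auto
      with card_heavy_le[OF t q, of r n] show "real (card {k. weight r n k \<ge> t}) \<le> t powr (- q) * c ^ n"
        by linarith
    qed
    also have "\<dots> = t powr (- q) * (\<Sum>n\<in>{n0..<N}. c ^ n)" by (simp add: sum_distrib_left)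
    also have "\<dots> \<le> t powr (- q) * (1 / (1 - c))"
      using c by (intro mult_left_mono sum_geometric_le) auto
    finally show ?thesis unfolding eq using t by (simp add: finite_heavy)
  qed
  define K where "K = real (card (charged n0)) + 2 ^ CARD('d) / (1 - c)"
  have "K > 0" using c by (simp add: K_def add_nonneg_pos)
  moreover have "finite (charged_stopping r n0 t) \<and> real (card (charged_stopping r n0 t)) \<le> K * t powr (- q)"
    if t: "0 < t" "t \<le> 1" for t
  proof -
    define U where "U = {n0} \<times> charged n0 \<union> (\<Union>(n, l)\<in>H t. {Suc n} \<times> dyadic_children l)"
    have sub: "charged_stopping r n0 t \<subseteq> U"
    proof
      fix p assume "p \<in> charged_stopping r n0 t"
      then obtain n k where p: "p = (n, k)" "(n, k) \<in> stopping r n0 t" "k \<in> charged n"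
        by (auto simp: charged_stopping_def)
      show "p \<in> U"
      proof (cases "n = n0")
        case False
        with p have n: "n > n0" "weight r (n - 1) (\<lambda>i. k i div 2) \<ge> t"
          by (auto simp: stopping_def)
        then have "(n - 1, \<lambda>i. k i div 2) \<in> H t" by (auto simp: H_def)
        moreover have "p \<in> {Suc (n - 1)} \<times> dyadic_children (\<lambda>i. k i div 2)"
          using n p by (auto simp: dyadic_children_def)
        ultimately show ?thesis unfolding U_def by blast
      qed (use p in \<open>auto simp: U_def\<close>)
    qed
    have finU: "finite U" unfolding U_def using H[OF t(1)] by (auto simp: finite_charged finite_dyadic_children)
    have "card U \<le> card ({n0} \<times> charged n0) + card (\<Union>(n, l)\<in>H t. {Suc n} \<times> dyadic_children l)"
      unfolding U_def by (rule card_Un_le)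
    also have "\<dots> \<le> card (charged n0) + (\<Sum>(n, l)\<in>H t. card ({Suc n} \<times> dyadic_children l))"
      using card_UN_le[of "H t" "\<lambda>(n, l). {Suc n} \<times> dyadic_children l"] H[OF t(1)]
      by (simp add: card_cartesian_product case_prod_beta)
    also have "\<dots> = card (charged n0) + 2 ^ CARD('d) * card (H t)"
      by (simp add: card_cartesian_product card_dyadic_children case_prod_beta)
    finally have "card (charged_stopping r n0 t) \<le> card (charged n0) + 2 ^ CARD('d) * card (H t)"
      using card_mono[OF finU sub] by linarith
    then have "real (card (charged_stopping r n0 t)) \<le> real (card (charged n0) + 2 ^ CARD('d) * card (H t))"
      by (rule of_nat_mono)
    also have "\<dots> = real (card (charged n0)) + 2 ^ CARD('d) * real (card (H t))" by simp
    also have "\<dots> \<le> real (card (charged n0)) * t powr (- q) + 2 ^ CARD('d) * (t powr (- q) / (1 - c))"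
    proof (intro add_mono mult_left_mono)
      have "1 \<le> t powr (- q)" using t q powr_mono_both'[of "- q" 0 t 1] powr_mono'[of "- q" 0 t] by simp
      then show "real (card (charged n0)) \<le> real (card (charged n0)) * t powr (- q)"
        using mult_left_mono[of 1 "t powr (- q)" "real (card (charged n0))"] by simp
    qed (use H[OF t(1)] in auto)
    also have "\<dots> = K * t powr (- q)" by (simp add: K_def algebra_simps)
    finally show ?thesis using finite_subset[OF sub finU] by blast
  qed
  ultimately show ?thesis by blast
qed

lemma AE_charged_stopping:
  assumes "r > 0" "t > 0"
  shows "AE x in \<nu>. \<exists>n. (n, dyadic_index n x) \<in> charged_stopping r n0 t"
  using AE_charged
proof eventually_elim
  case (elim x)
  obtain n where "(n, dyadic_index n x) \<in> stopping r n0 t" using stopping_exists[OF assms] .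
  with elim show ?case by (auto simp: charged_stopping_def)
qed

text \<open>The charged stopping cubes cover almost everything, so m of them with weight below t
  give an r-th power error of order m t. With t of order m^(-1/q) this is m^(-(1 - q) / q); the r-th
  root gives the stated rate.\<close>

lemma quantization_error_upper_subcritical:
  assumes r: "r > 0" and q: "0 < q" "q < 1" and sub: "Lq_spectrum \<nu> q < ereal (r * q)"
  shows "\<exists>K>0. \<forall>\<^sub>F m in sequentially. quantization_error \<nu> r m \<le> K * real m powr (- ((1 - q) / (q * r)))"
proof -
  obtain n0 C where C: "C > 0" and CS: "\<And>t. 0 < t \<Longrightarrow> t \<le> 1 \<Longrightarrow> finite (charged_stopping r n0 t) \<and>
      real (card (charged_stopping r n0 t)) \<le> C * t powr (- q)"
    using card_charged_stopping[OF r q(1) sub] by blast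
  define K where "K = (real CARD('d) powr r * C powr (1 / q)) powr (1 / r)"
  have "K > 0" using C by (simp add: K_def)
  moreover have "\<forall>\<^sub>F m in sequentially. quantization_error \<nu> r m \<le> K * real m powr (- ((1 - q) / (q * r)))"
    using eventually_ge_at_top[of "max 1 (nat \<lceil>C\<rceil>)"]
  proof eventually_elim
    case (elim m)
    then have m: "m \<ge> 1" "real m \<ge> C" by (auto simp: max_def split: if_splits) linarith+
    \<comment> \<open>Solves C t^(-q) = m, so that at most m cubes are used; m \<ge> C ensures t
      \<le> 1.\<close>
    define t where "t = (C / real m) powr (1 / q)"
    have t: "0 < t" "t \<le> 1" using m C q by (auto simp: t_def powr_le1)
    have tq: "C * t powr (- q) = real m"
      using m C q by (simp add: t_def powr_powr powr_minus)
    define P where "P = (\<lambda>(n, k). dyadic_cube n k :: (real^'d) set) ` charged_stopping r n0 t"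
    have fin: "finite (charged_stopping r n0 t)" and "real (card (charged_stopping r n0 t)) \<le> real m"
      using CS[OF t] tq by auto
    then have card: "card P \<le> m" using card_image_le[OF fin] unfolding P_def by (meson of_nat_le_iff order_trans)
    have "quantization_error \<nu> r m \<le> (real CARD('d) powr r * (real (card P) * t)) powr (1 / r)"
    proof (rule quantization_error_upper[OF r])
      show "finite P" using fin by (simp add: P_def)
      show "P \<subseteq> dyadic_cubes" by (auto simp: P_def dyadic_cubes_def dyadic_level_def)
      show "AE x in \<nu>. x \<in> \<Union>P"
        using AE_charged_stopping[OF r t(1), of n0]
      proof eventually_elim
        case (elim x)
        then show ?case unfolding P_def using mem_dyadic_cube_self[of x] by fast
      qed
      show "cube_weight \<nu> r Q \<le> t" if "Q \<in> P" for Q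
        using that by (auto simp: P_def charged_stopping_def stopping_def cube_weight_eq)
    qed (rule card)
    also have "\<dots> \<le> (real CARD('d) powr r * (real m * t)) powr (1 / r)"
      using card t r by (intro powr_mono2 mult_left_mono mult_right_mono) auto
    also have "real m * t = C powr (1 / q) * real m powr (- ((1 - q) / q))"
    proof -
      have "- ((1 - q) / q) = 1 - 1 / q" using q by (simp add: field_simps)
      then show ?thesis using m C by (simp add: t_def powr_divide powr_diff)
    qed
    also have "(real CARD('d) powr r * (C powr (1 / q) * real m powr (- ((1 - q) / q)))) powr (1 / r)
        = K * real m powr (- ((1 - q) / (q * r)))"
      using r C by (simp add: K_def powr_mult powr_powr mult.assoc)
    finally show ?case .
  qed
  ultimately show ?thesis by blast
qed

lemma quantization_error_eventually_less_1:
  assumes r: "r > 0"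
  shows "\<forall>\<^sub>F m in sequentially. quantization_error \<nu> r m < 1"
proof -
  obtain q where q: "0 < q" "q < 1" "Lq_spectrum \<nu> q < ereal (r * q)"
    using subcritical_exponent_exists[OF r] by blast
  obtain K where K: "K > 0"
    and ev: "\<forall>\<^sub>F m in sequentially. quantization_error \<nu> r m \<le> K * real m powr (- ((1 - q) / (q * r)))"
    using quantization_error_upper_subcritical[OF r q] by blast
  have "(1 - q) / (q * r) > 0" using q r by simp
  then have "(\<lambda>m. K * real m powr (- ((1 - q) / (q * r)))) \<longlonglongrightarrow> 0" by real_asymp
  then have "\<forall>\<^sub>F m in sequentially. K * real m powr (- ((1 - q) / (q * r))) < 1"
    by (rule order_tendstoD) simp
  with ev show ?thesis by eventually_elim simp
qed

lemma upper_quantization_dim_le_subcritical: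
  assumes r: "r > 0" and q: "0 < q" "q < 1" and sub: "Lq_spectrum \<nu> q < ereal (r * q)"
  shows "upper_quantization_dim \<nu> r \<le> ereal (r * q / (1 - q))"
proof -
  obtain K where K: "K > 0"
    and ev: "\<forall>\<^sub>F m in sequentially. quantization_error \<nu> r m \<le> K * real m powr (- ((1 - q) / (q * r)))"
    using quantization_error_upper_subcritical[OF r q sub] by blast
  have "(1 - q) / (q * r) > 0" using q r by simp
  from upper_quantization_dim_le[OF K this ev] show ?thesis by (simp add: mult.commute)
qed

section \<open>Lower bounds\<close>

text \<open>The product of t with the number of cubes is at least t^(1 - q) = (t^(-q))^(-(1 - q) /
  q). Here L bounds the ratio of t^(-q) to m, which turns this into a power of m.\<close>

lemma quantization_error_lower_count:
  assumes r: "r > 0" and q: "0 < q" "q < 1" and t: "t > 0"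
    and G: "finite G" "\<And>k. k \<in> G \<Longrightarrow> t \<le> weight r n k" "t powr (- q) \<le> real (card G)"
    and m: "m \<ge> 1" "2 * 3 ^ CARD('d) * m \<le> card G" and L: "t powr (- q) \<le> L * real m" "L > 0"
  shows "(L powr (- ((1 - q) / q)) / 2) powr (1 / r) * real m powr (- ((1 - q) / (q * r)))
    \<le> quantization_error \<nu> r m"
proof -
  have e: "(t powr (- q)) powr (- ((1 - q) / q)) = t powr (1 - q)"
    using q by (simp add: powr_powr)
  have "(L * real m) powr (- ((1 - q) / q)) \<le> (t powr (- q)) powr (- ((1 - q) / q))"
    using L t q by (intro powr_mono2') auto
  also have "\<dots> = t * t powr (- q)"
    unfolding e using t by (simp add: powr_diff powr_minus divide_inverse)
  also have "\<dots> \<le> t * real (card G)" using G t by (intro mult_left_mono) auto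
  finally have "((L * real m) powr (- ((1 - q) / q)) / 2) powr (1 / r) \<le> (t * real (card G) / 2) powr (1 / r)"
    using r by (intro powr_mono2 divide_right_mono) auto
  also have "\<dots> \<le> quantization_error \<nu> r m"
    using r G(1,2) t m by (intro quantization_error_lower) auto
  also have "((L * real m) powr (- ((1 - q) / q)) / 2) powr (1 / r)
      = (L powr (- ((1 - q) / q)) / 2) powr (1 / r) * real m powr (- ((1 - q) / (q * r)))"
    using L m r by (simp add: powr_mult powr_divide powr_powr)
  finally show ?thesis .
qed

text \<open>The weights in the dyadic bands \<open>[2\<^sup>-\<^sup>i\<^sup>-\<^sup>1, 2\<^sup>-\<^sup>i]\<close> contribute the terms of a geometric series.\<close>

lemma sum_weight_powr_bounded:
  assumes r: "r > 0" and pq: "0 < p" "p < q"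
    and few: "\<And>t. 0 < t \<Longrightarrow> t \<le> 1 \<Longrightarrow> real (card {k. weight r n k \<ge> t}) \<le> t powr (- p)"
  shows "(\<Sum>k\<in>charged n. weight r n k powr q) \<le> 2 powr p / (1 - 2 powr (p - q))"
proof -
  define c where "c = 2 powr (p - q)"
  have c: "0 < c" "c < 1" using pq by (auto simp: c_def powr_less_one)
  \<comment> \<open>The number of the dyadic band that contains the weight.\<close>
  define j where "j k = nat \<lfloor>- log 2 (weight r n k)\<rfloor>" for k
  have j: "weight r n k \<le> 2 powr (- real (j k))" "2 powr (- (real (j k) + 1)) \<le> weight r n k"
    if "k \<in> charged n" for k
  proof -
    have w: "0 < weight r n k" "weight r n k \<le> 1" using weight_pos weight_le_1[OF r] that by auto
    then have "- log 2 (weight r n k) \<ge> 0" by simp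
    then have "real (j k) \<le> - log 2 (weight r n k)" "- log 2 (weight r n k) \<le> real (j k) + 1"
      by (auto simp: j_def)
    then have "log 2 (weight r n k) \<le> - real (j k)" "- (real (j k) + 1) \<le> log 2 (weight r n k)"
      by linarith+
    then show "weight r n k \<le> 2 powr (- real (j k))" "2 powr (- (real (j k) + 1)) \<le> weight r n k"
      using w by (simp_all add: log_le_iff le_log_iff)
  qed
  have "(\<Sum>k\<in>charged n. weight r n k powr q)
      = (\<Sum>i\<in>j ` charged n. \<Sum>k | k \<in> charged n \<and> j k = i. weight r n k powr q)"
    by (rule sum.image_gen[OF finite_charged])
  also have "\<dots> \<le> (\<Sum>i\<in>j ` charged n. 2 powr p * c ^ i)"
  proof (intro sum_mono)
    fix i
    \<comment> \<open>Lower end of band i: it holds at most t^(-p) = 2^(p (i + 1)) cubes, each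
      contributing at most 2^(-i q), in total 2^p c^i.\<close>
    define t :: real where "t = 2 powr (- (real i + 1))"
    have t: "0 < t" "t \<le> 1" using powr_mono[of "- (real i + 1)" 0 2] by (auto simp: t_def)
    have "(\<Sum>k | k \<in> charged n \<and> j k = i. weight r n k powr q)
        \<le> real (card {k. k \<in> charged n \<and> j k = i}) * (2 powr (- real i)) powr q"
      using j(1) pq by (intro sum_bounded_above) (auto intro!: powr_mono2 weight_nonneg)
    also have "\<dots> \<le> real (card {k. weight r n k \<ge> t}) * (2 powr (- real i)) powr q"
      using j(2) t by (intro mult_right_mono of_nat_mono card_mono finite_heavy) (auto simp: t_def)
    also have "\<dots> \<le> t powr (- p) * (2 powr (- real i)) powr q"
      by (intro mult_right_mono few t) auto
    also have "\<dots> = 2 powr p * c ^ i"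
      by (simp add: t_def c_def powr_powr algebra_simps flip: powr_add powr_realpow)
    finally show "(\<Sum>k | k \<in> charged n \<and> j k = i. weight r n k powr q) \<le> 2 powr p * c ^ i" .
  qed
  also have "\<dots> = 2 powr p * (\<Sum>i\<in>j ` charged n. c ^ i)" by (simp add: sum_distrib_left)
  also have "\<dots> \<le> 2 powr p * (1 / (1 - c))"
    using c by (intro mult_left_mono sum_geometric_le) (auto simp: finite_charged)
  finally show ?thesis by (simp add: c_def)
qed

text \<open>For an exponent p strictly between q and the critical one, the sums of p-th powers of
  weights are unbounded along infinitely many levels. Few heavy cubes at every threshold would bound
  them. The second estimate follows from t \<le> 2^(-n r) and makes the counts grow with the
  level.\<close>

lemma many_heavy_cubes:
  assumes r: "r > 0" and q: "0 < q" "q < critical_exponent \<nu> r"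
  shows "\<exists>\<^sub>F n in sequentially. \<exists>t. 0 < t \<and> t powr (- q) \<le> real (card {k. weight r n k \<ge> t}) \<and>
    2 powr (real n * r * q) \<le> real (card {k. weight r n k \<ge> t})"
proof -
  obtain p where p: "q < p" "p < critical_exponent \<nu> r" using dense q(2) by blast
  have "Lq_spectrum \<nu> p > ereal (r * p)" using spectrum_below_critical[OF r _ p(2)] p q by simp
  then obtain s where s: "r * p < s" "ereal s < Lq_spectrum \<nu> p"
    using ereal_dense2 by force
  have freq: "\<exists>\<^sub>F n in sequentially. s < Lq_spectrum_level \<nu> n p"
    using frequently_less_Limsup[OF s(2)[unfolded Lq_spectrum_def]] by simp
  have "s - r * p > 0" using s by simp
  then have "\<forall>\<^sub>F n in sequentially. 2 powr q / (1 - 2 powr (q - p)) + 1 \<le> 2 powr (real n * (s - r * p))"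
    by (rule eventually_ge_powr_at_top)
  then have "\<exists>\<^sub>F n in sequentially. s < Lq_spectrum_level \<nu> n p \<and>
      (2 powr q / (1 - 2 powr (q - p)) + 1 \<le> 2 powr (real n * (s - r * p)) \<and> n \<ge> 1)"
    by (intro frequently_eventually_frequently[OF freq] eventually_conj eventually_ge_at_top)
  then show ?thesis
  proof (rule frequently_elim1, elim conjE)
    fix n :: nat
    assume n: "s < Lq_spectrum_level \<nu> n p" "n \<ge> 1"
      and big: "2 powr q / (1 - 2 powr (q - p)) + 1 \<le> 2 powr (real n * (s - r * p))"
    have "ln (2 powr (real n * s)) < ln (power_sum n p)"
      using n by (simp add: Lq_spectrum_level_eq pos_less_divide_eq ln_powr mult_ac)
    then have "2 powr (real n * s) < power_sum n p"
      by (subst (asm) ln_less_cancel_iff) (auto simp: power_sum_pos)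
    then have "2 powr (real n * s) * 2 powr (- (real n * r * p)) \<le> power_sum n p * 2 powr (- (real n * r * p))"
      by (intro mult_right_mono) auto
    also have "\<dots> = (\<Sum>k\<in>charged n. weight r n k powr p)"
      by (simp add: weight_powr power_sum_def sum_distrib_right)
    also have "2 powr (real n * s) * 2 powr (- (real n * r * p)) = 2 powr (real n * (s - r * p))"
      by (simp add: algebra_simps flip: powr_add)
    finally have "2 powr q / (1 - 2 powr (q - p)) < (\<Sum>k\<in>charged n. weight r n k powr p)"
      using big by linarith
    \<comment> \<open>Contraposition of \<open>sum_weight_powr_bounded\<close>, used with q as the
      counting exponent and the larger p as the summation exponent.\<close>
    then obtain t where t: "0 < t" "t \<le> 1" "t powr (- q) < real (card {k. weight r n k \<ge> t})"
      using sum_weight_powr_bounded[OF r q(1) p(1), of n] by (force simp: not_le[symmetric])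
    then have "{k. weight r n k \<ge> t} \<noteq> {}" by (metis card.empty of_nat_0 powr_ge_zero not_le)
    then obtain k where "t \<le> weight r n k" by blast
    then have "t \<le> 2 powr (- (real n * r))" using weight_le[of r n k] by linarith
    then have "(2 powr (- (real n * r))) powr (- q) \<le> t powr (- q)"
      using q t by (intro powr_mono2') auto
    then have "2 powr (real n * r * q) \<le> t powr (- q)" by (simp add: powr_powr)
    with t show "\<exists>t. 0 < t \<and> t powr (- q) \<le> real (card {k. weight r n k \<ge> t}) \<and>
        2 powr (real n * r * q) \<le> real (card {k. weight r n k \<ge> t})"
      by (intro exI[of _ t]) auto
  qed
qed

lemma quantization_error_lower_frequently:
  assumes r: "r > 0" and q: "0 < q" "q < critical_exponent \<nu> r"
  shows "\<exists>K>0. \<exists>\<^sub>F m in sequentially. K * real m powr (- ((1 - q) / (q * r))) \<le> quantization_error \<nu> r m"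
proof -
  define D where "D = (3::nat) ^ CARD('d)"
  have D: "D \<ge> 1" by (simp add: D_def)
  \<comment> \<open>With m = N div (2 D) one has N < 2 D (m + 1), which is at most 4 D m since m
    \<ge> 1.\<close>
  define L where "L = 4 * real D"
  have q1: "q < 1" using q critical_exponent_less_1[OF r] by simp
  define K where "K = (L powr (- ((1 - q) / q)) / 2) powr (1 / r)"
  have "K > 0" using D by (simp add: K_def L_def)
  moreover have "\<exists>\<^sub>F m in sequentially. K * real m powr (- ((1 - q) / (q * r))) \<le> quantization_error \<nu> r m"
    unfolding frequently_sequentially
  proof
    fix M :: nat
    have "r * q > 0" using r q by simp
    then have "\<forall>\<^sub>F n in sequentially. c \<le> 2 powr (real n * (r * q))" for c :: real
      by (intro eventually_ge_powr_at_top)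
    \<comment> \<open>The growing counts turn infinitely many levels into arbitrarily large
      m.\<close>
    from frequently_eventually_frequently[OF many_heavy_cubes[OF r q] this[of "real (2 * D * (M + 1))"]]
    obtain n t where nt: "0 < t" "t powr (- q) \<le> real (card {k. weight r n k \<ge> t})"
      "real (2 * D * (M + 1)) \<le> real (card {k. weight r n k \<ge> t})"
      by (auto simp: mult.assoc dest!: frequently_ex)
    define N where "N = card {k. weight r n k \<ge> t}"
    define m where "m = N div (2 * D)"
    have N: "2 * D * (M + 1) \<le> N" using nt(3) unfolding N_def of_nat_le_iff .
    then have m: "m \<ge> M + 1" using D by (simp add: m_def less_eq_div_iff_mult_less_eq mult.commute)
    have N1: "2 * D * m \<le> N" unfolding m_def by simp
    have "N < 2 * D * (m + 1)"
      using D unfolding m_def by (metis dividend_less_times_div mult_pos_pos zero_less_numeral less_le_trans zero_less_one mult_Suc_right add.commute Suc_eq_plus1)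
    also have "\<dots> \<le> 2 * D * (2 * m)" using m by (intro mult_left_mono) auto
    finally have "real N \<le> real (2 * D * (2 * m))" by (intro of_nat_mono) simp
    also have "\<dots> = L * real m" by (simp add: L_def)
    finally have "real N \<le> L * real m" .
    then have "K * real m powr (- ((1 - q) / (q * r))) \<le> quantization_error \<nu> r m"
      unfolding K_def using nt m N1 D finite_heavy[OF nt(1)]
      by (intro quantization_error_lower_count[OF r q(1) q1 nt(1), where G = "{k. weight r n k \<ge> t}" and n = n])
         (auto simp: N_def D_def L_def)
    then show "\<exists>m\<ge>M. K * real m powr (- ((1 - q) / (q * r))) \<le> quantization_error \<nu> r m"
      using m by (intro exI[of _ m]) auto
  qed
  ultimately show ?thesis by blast
qed

section \<open>Coarse multifractal dimension\<close>

lemma heavy_cube_count_eq: "heavy_cube_count \<nu> \<alpha> r n = card {k. weight r n k \<ge> 2 powr (- \<alpha> * real n)}"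
proof -
  have "{C \<in> dyadic_level n. cube_weight \<nu> r C \<ge> 2 powr (- \<alpha> * real n)}
      = dyadic_cube n ` {k. weight r n k \<ge> 2 powr (- \<alpha> * real n)}"
    by (auto simp: dyadic_level_def cube_weight_eq)
  then show ?thesis
    unfolding heavy_cube_count_def by (simp add: card_image inj_on_subset[OF inj_dyadic_cube])
qed

lemma lower_coarse_dim_at_nonneg: "lower_coarse_dim_at \<nu> r \<alpha> \<ge> 0"
  unfolding lower_coarse_dim_at_def by (intro Liminf_bounded) auto

lemma lower_coarse_dim_nonneg: "lower_coarse_dim \<nu> r \<ge> 0"
proof -
  have "0 \<le> lower_coarse_dim_at \<nu> r 1 / ereal 1" using lower_coarse_dim_at_nonneg by simp
  also have "\<dots> \<le> lower_coarse_dim \<nu> r" unfolding lower_coarse_dim_def by (rule SUP_upper) simp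
  finally show ?thesis .
qed

text \<open>Heavy cubes are available at every large level, with thresholds 2^(-\<alpha> n).
  Consecutive thresholds differ by a fixed factor, so each large m is matched by a level up to a
  constant.\<close>

lemma quantization_error_lower_coarse:
  assumes r: "r > 0" and s: "s > 0" "ereal s < lower_coarse_dim \<nu> r"
  shows "s < 1 \<and> (\<exists>K>0. \<forall>\<^sub>F m in sequentially.
    K * real m powr (- ((1 - s) / (s * r))) \<le> quantization_error \<nu> r m)"
proof -
  obtain \<alpha> where \<alpha>: "\<alpha> > 0" "ereal s < lower_coarse_dim_at \<nu> r \<alpha> / ereal \<alpha>"
    using s(2) by (auto simp: lower_coarse_dim_def less_SUP_iff)
  then have "ereal (s * \<alpha>) < lower_coarse_dim_at \<nu> r \<alpha>"
    by (cases "lower_coarse_dim_at \<nu> r \<alpha>") (auto simp: field_simps)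
  then have "\<forall>\<^sub>F n in sequentially. s * \<alpha> < max (ln (real (heavy_cube_count \<nu> \<alpha> r n))) 0 / ln (2 ^ n)"
    unfolding lower_coarse_dim_at_def by (auto dest!: less_LiminfD)
  then obtain n1 where n1: "\<And>n. n \<ge> n1 \<Longrightarrow>
      s * \<alpha> < max (ln (real (heavy_cube_count \<nu> \<alpha> r n))) 0 / ln (2 ^ n)"
    by (auto simp: eventually_sequentially)
  define t where "t n = 2 powr (- \<alpha> * real n)" for n
  define G where "G n = {k. weight r n k \<ge> t n}" for n
  define n0 where "n0 = max n1 1"
  have tpos: "t n > 0" for n by (simp add: t_def)
  have G: "t n powr (- s) < real (card (G n))" if "n \<ge> n0" for n
  proof -
    have n: "n \<ge> n1" "n \<ge> 1" using that by (auto simp: n0_def)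
    \<comment> \<open>The left side is positive, so the maximum is the logarithm and the count is
      nonzero.\<close>
    have "s * \<alpha> * (real n * ln 2) < max (ln (real (card (G n)))) 0"
      using n1[OF n(1)] n(2) by (simp add: heavy_cube_count_eq G_def t_def ln_realpow pos_less_divide_eq)
    moreover have "s * \<alpha> * (real n * ln 2) > 0" using s \<alpha> n by simp
    ultimately have *: "s * \<alpha> * (real n * ln 2) < ln (real (card (G n)))" "ln (real (card (G n))) > 0"
      by linarith+
    then have pos: "real (card (G n)) > 0" by (cases "card (G n) = 0") auto
    have "ln (t n powr (- s)) = s * \<alpha> * (real n * ln 2)" by (simp add: t_def ln_powr)
    with *(1) have "ln (t n powr (- s)) < ln (real (card (G n)))" by simp
    then show ?thesis using pos by (subst (asm) ln_less_cancel_iff) (auto simp: t_def)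
  qed
  \<comment> \<open>The weights at level n0 add up to at most 1. More than t^(-s) of them are at
    least t, so t^(1 - s) < 1 with t < 1.\<close>
  have s1: "s < 1"
  proof -
    have n0: "n0 \<ge> 1" by (simp add: n0_def)
    have "t n0 * t n0 powr (- s) < t n0 * real (card (G n0))"
      using G[of n0] tpos[of n0] by simp
    also have "\<dots> \<le> (\<Sum>k\<in>G n0. weight r n0 k)"
      using sum_bounded_below[of "G n0" "t n0" "weight r n0"] by (simp add: G_def mult.commute)
    also have "\<dots> \<le> (\<Sum>k\<in>charged n0. weight r n0 k)"
      using charged_if_weight_ge[OF tpos] by (intro sum_mono2 finite_charged) (auto simp: G_def weight_nonneg)
    also have "\<dots> = 2 powr (- (real n0 * r))"
      by (simp add: weight_def sum_mass flip: sum_distrib_right)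
    also have "\<dots> \<le> 1" using r powr_mono[of "- (real n0 * r)" 0 2] by simp
    also have "t n0 * t n0 powr (- s) = t n0 powr (1 - s)"
      using tpos[of n0] by (simp add: powr_diff powr_minus divide_inverse)
    also have "\<dots> = 2 powr (- \<alpha> * real n0 * (1 - s))" by (simp add: t_def powr_powr)
    finally have "2 powr (- \<alpha> * real n0 * (1 - s)) < 2 powr 0" by simp
    then have "0 < \<alpha> * real n0 * (1 - s)" by (simp only: powr_less_cancel_iff)
    moreover have "\<alpha> * real n0 > 0" using \<alpha> n0 by simp
    ultimately show "s < 1" by (simp add: zero_less_mult_iff)
  qed
  define D where "D = (3::nat) ^ CARD('d)"
  have D: "D \<ge> 1" by (simp add: D_def)
  \<comment> \<open>The first factor pays for rounding the level up, the second for asking for 2 D m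
    cubes.\<close>
  define L where "L = 2 powr (\<alpha> * s) * (2 * real D)"
  have L: "L > 0" using D by (simp add: L_def)
  define K where "K = (L powr (- ((1 - s) / s)) / 2) powr (1 / r)"
  have "K > 0" using L by (simp add: K_def)
  moreover have "\<forall>\<^sub>F m in sequentially. K * real m powr (- ((1 - s) / (s * r))) \<le> quantization_error \<nu> r m"
    using eventually_ge_at_top[of "max 1 (nat \<lceil>2 powr (\<alpha> * s * real n0)\<rceil>)"]
  proof eventually_elim
    case (elim m)
    then have m: "m \<ge> 1" "2 powr (\<alpha> * s * real n0) \<le> real m" by (auto simp: max_def split: if_splits) linarith+
    \<comment> \<open>The real level at which the threshold to the power -s equals 2 D m; the lower
      bound on m gives y \<ge> n0.\<close>
    define y where "y = log 2 (2 * real D * real m) / (\<alpha> * s)"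
    define n where "n = nat \<lceil>y\<rceil>"
    have as: "\<alpha> * s > 0" using \<alpha> s by simp
    have Dm: "real m \<le> 2 * real D * real m" "2 * real D * real m > 0" using D m by (auto simp: mult_le_cancel_right1)
    have "2 powr (\<alpha> * s * real n0) \<le> 2 * real D * real m" using m Dm by linarith
    then have "\<alpha> * s * real n0 \<le> log 2 (2 * real D * real m)" using Dm by (simp add: le_log_iff)
    then have y: "y \<ge> real n0" using as by (simp add: y_def pos_le_divide_eq mult.commute)
    then have n: "n \<ge> n0" "y \<le> real n" "real n \<le> y + 1" unfolding n_def by linarith+
    have two: "2 powr (\<alpha> * s * y) = 2 * real D * real m" using \<alpha>(1) s(1) Dm by (simp add: y_def)
    have tn: "t n powr (- s) = 2 powr (\<alpha> * s * real n)" by (simp add: t_def powr_powr mult_ac)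
    have "2 * real D * real m \<le> t n powr (- s)"
      unfolding tn two[symmetric] using as n by (intro powr_mono mult_left_mono) auto
    moreover have "real (2 * D * m) = 2 * real D * real m" by simp
    ultimately have "real (2 * D * m) \<le> real (card (G n))" using G[OF n(1)] by linarith
    then have c1: "2 * D * m \<le> card (G n)" unfolding of_nat_le_iff .
    have "t n powr (- s) \<le> 2 powr (\<alpha> * s * (y + 1))" unfolding tn using as n by (intro powr_mono mult_left_mono) auto
    also have "\<dots> = L * real m" using two by (simp add: L_def distrib_left powr_add)
    finally have c2: "t n powr (- s) \<le> L * real m" .
    show ?case unfolding K_def
      using G[OF n(1)] c1 c2 m L finite_heavy[OF tpos]
      by (intro quantization_error_lower_count[OF r s(1) s1 tpos[of n], where G = "G n" and n = n])
         (auto simp: G_def D_def)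
  qed
  ultimately show ?thesis using s1 by blast
qed

section \<open>Partition entropy\<close>

text \<open>P omits the members of mass zero. There are only countably many dyadic cubes, so
  together these form a null set and P still covers almost everything.\<close>

lemma partition_codebook:
  assumes cube: "AE x in \<nu>. x \<in> half_open_unit_cube" and P: "P \<in> dyadic_partitions \<nu>"
  shows "finite P" "P \<subseteq> dyadic_cubes" "P \<noteq> {}" "AE x in \<nu>. x \<in> \<Union>P"
proof -
  obtain P' where P': "P' \<subseteq> dyadic_cubes" "partition_on half_open_unit_cube P'"
      "P = {C \<in> P'. measure \<nu> C > 0}" and fin: "finite P"
    using P by (auto simp: dyadic_partitions_def)
  show "finite P" "P \<subseteq> dyadic_cubes" using fin P' by auto
  have count: "countable (P' - P)" using countable_dyadic_cubes P'(1) by (meson countable_subset Diff_subset order_trans)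
  have "AE x in \<nu>. \<forall>C\<in>P' - P. x \<notin> C"
  proof (subst AE_ball_countable[OF count], intro ballI)
    fix C assume C: "C \<in> P' - P"
    then have "C \<in> sets \<nu>" using P'(1) sets_dyadic_cubes sets_eq by blast
    moreover have "measure \<nu> C = 0" using C P'(3) by (auto simp: zero_less_measure_iff)
    ultimately show "AE x in \<nu>. x \<notin> C" by (simp add: prob_eq_0)
  qed
  with cube show cov: "AE x in \<nu>. x \<in> \<Union>P"
  proof eventually_elim
    case (elim x)
    have "half_open_unit_cube = \<Union>P'" using P'(2) by (auto simp: partition_on_def)
    with elim show ?case by blast
  qed
  show "P \<noteq> {}"
  proof
    assume "P = {}"
    with cov have "AE x in \<nu>. False" by simp
    then show False by simp
  qed
qed

text \<open>The stopping cubes inside the unit cube, charged or not, partition it: every point has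
  one and two never overlap. Removing those of mass zero leaves charged stopping cubes only.\<close>

lemma stopping_partition:
  assumes cube: "AE x in \<nu>. x \<in> half_open_unit_cube" and r: "r > 0" and t: "t > 0"
    and fin: "finite (charged_stopping r n0 t)"
  shows "\<exists>P\<in>dyadic_partitions \<nu>. Max (cube_weight \<nu> r ` P) < t \<and> card P \<le> card (charged_stopping r n0 t)"
proof -
  define P' where "P' = {dyadic_cube n k | n k. (n, k) \<in> stopping r n0 t \<and>
      dyadic_cube n k \<subseteq> (half_open_unit_cube :: (real^'d) set)}"
  define P where "P = {C \<in> P'. measure \<nu> C > 0}"
  have sub: "P \<subseteq> (\<lambda>(n, k). dyadic_cube n k) ` charged_stopping r n0 t"
    by (auto simp: P_def P'_def charged_stopping_def charged_def mass_def)
  have part: "partition_on half_open_unit_cube P'"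
  proof (rule partition_onI)
    show "\<Union>P' = half_open_unit_cube"
    proof
      show "half_open_unit_cube \<subseteq> \<Union>P'"
      proof
        fix x :: "real^'d" assume x: "x \<in> half_open_unit_cube"
        obtain n where n: "(n, dyadic_index n x) \<in> stopping r n0 t" using stopping_exists[OF r t] .
        have "dyadic_index 0 x = (\<lambda>_. 0)" using x by (simp flip: dyadic_cube_0_0 add: mem_dyadic_cube_iff)
        then have "dyadic_cube n (dyadic_index n x) \<subseteq> half_open_unit_cube"
          using dyadic_cube_nested[of 0 n x] by (simp add: dyadic_cube_0_0)
        with n show "x \<in> \<Union>P'" unfolding P'_def using mem_dyadic_cube_self[of x n] by blast
      qed
    qed (auto simp: P'_def)
    show "disjnt p q" if "p \<in> P'" "q \<in> P'" "p \<noteq> q" for p q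
      using that stopping_unique[OF r] unfolding P'_def disjnt_def by blast
    show "{} \<notin> P'" using dyadic_cube_nonempty by (auto simp: P'_def)
  qed
  have "finite P" using sub fin finite_surj by blast
  moreover have "P' \<subseteq> dyadic_cubes" by (auto simp: P'_def dyadic_cubes_def dyadic_level_def)
  ultimately have P: "P \<in> dyadic_partitions \<nu>" using part by (auto simp: dyadic_partitions_def P_def)
  moreover have "Max (cube_weight \<nu> r ` P) < t"
    using partition_codebook[OF cube P]
    by (subst Max_less_iff) (auto simp: P_def P'_def stopping_def cube_weight_eq)
  moreover have "card P \<le> card (charged_stopping r n0 t)"
    using sub fin by (rule surj_card_le[rotated])
  ultimately show ?thesis by blast
qed

lemma lower_partition_entropy_le:
  assumes cube: "AE x in \<nu>. x \<in> half_open_unit_cube" and r: "r > 0" and q: "0 < q"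
    and sub: "Lq_spectrum \<nu> q < ereal (r * q)"
  shows "lower_partition_entropy \<nu> r \<le> ereal q"
proof -
  obtain n0 C where C: "C > 0" and CS: "\<And>t. 0 < t \<Longrightarrow> t \<le> 1 \<Longrightarrow> finite (charged_stopping r n0 t) \<and>
      real (card (charged_stopping r n0 t)) \<le> C * t powr (- q)"
    using card_charged_stopping[OF r q sub] by blast
  have le: "real (min_partition_card \<nu> r x) \<le> C * x powr q" if x: "x \<ge> 1" for x
  proof -
    have t: "0 < 1 / x" "1 / x \<le> 1" using x by auto
    obtain P where P: "P \<in> dyadic_partitions \<nu>" "Max (cube_weight \<nu> r ` P) < 1 / x"
        "card P \<le> card (charged_stopping r n0 (1 / x))"
      using stopping_partition[OF cube r t(1)] CS[OF t] by blast
    then have "min_partition_card \<nu> r x \<le> card P"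
      unfolding min_partition_card_def by (intro cInf_lower) auto
    with P CS[OF t] have "real (min_partition_card \<nu> r x) \<le> C * (1 / x) powr (- q)" by linarith
    also have "(1 / x) powr (- q) = x powr q" using x by (simp add: powr_minus powr_divide)
    finally show ?thesis .
  qed
  have "\<forall>\<^sub>F x in at_top. ereal (ln (real (min_partition_card \<nu> r x)) / ln x)
      \<le> ereal ((\<bar>ln C\<bar> + q * ln x) / ln x)"
    using eventually_gt_at_top[of 1]
  proof eventually_elim
    case (elim x)
    \<comment> \<open>The absolute value also covers the count 0, for which the logarithm is 0 by
      convention.\<close>
    have "ln (real (min_partition_card \<nu> r x)) \<le> \<bar>ln C\<bar> + q * ln x"
    proof (cases "min_partition_card \<nu> r x = 0")
      case False
      then have "ln (real (min_partition_card \<nu> r x)) \<le> ln (C * x powr q)"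
        using le[of x] elim by (intro ln_mono) auto
      also have "\<dots> = ln C + q * ln x" using C elim by (simp add: ln_mult ln_powr)
      finally show ?thesis by linarith
    qed (use elim q in auto)
    then show ?case using elim by (simp add: divide_right_mono)
  qed
  then have "lower_partition_entropy \<nu> r \<le> Liminf at_top (\<lambda>x. ereal ((\<bar>ln C\<bar> + q * ln x) / ln x))"
    unfolding lower_partition_entropy_def by (rule Liminf_mono)
  also have "((\<lambda>x. (\<bar>ln C\<bar> + q * ln x) / ln x) \<longlongrightarrow> q) at_top" by real_asymp
  then have "Liminf at_top (\<lambda>x. ereal ((\<bar>ln C\<bar> + q * ln x) / ln x)) = ereal q"
    by (intro lim_imp_Liminf) (auto simp: tendsto_ereal)
  finally show ?thesis .
qed

lemma lower_partition_entropy_nonneg: "lower_partition_entropy \<nu> r \<ge> 0"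
  unfolding lower_partition_entropy_def
proof (intro Liminf_bounded)
  show "\<forall>\<^sub>F x in at_top. 0 \<le> ereal (ln (real (min_partition_card \<nu> r x)) / ln x)"
    using eventually_gt_at_top[of 1]
  proof eventually_elim
    case (elim x)
    have "ln (real (min_partition_card \<nu> r x)) \<ge> 0" by (cases "min_partition_card \<nu> r x") auto
    with elim show ?case by simp
  qed
qed

lemma lower_partition_entropy_le_critical:
  assumes "AE x in \<nu>. x \<in> half_open_unit_cube" and "r > 0"
  shows "lower_partition_entropy \<nu> r \<le> ereal (critical_exponent \<nu> r)"
proof (rule ereal_le_epsilon2)
  fix e :: real assume "e > 0"
  then have "critical_exponent \<nu> r + e > critical_exponent \<nu> r" "critical_exponent \<nu> r + e > 0"
    using critical_exponent_nonneg[OF assms(2)] by auto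
  then show "lower_partition_entropy \<nu> r \<le> ereal (critical_exponent \<nu> r) + ereal e"
    using lower_partition_entropy_le[OF assms, of "critical_exponent \<nu> r + e"]
      spectrum_above_critical[OF assms(2)] by simp
qed

text \<open>At arbitrarily large scales x an optimal partition has fewer than x^s cubes, each of
  weight below 1/x. The r-th power error is then of order x^(s - 1) = (x^s)^(-(1 - s) / s).\<close>

lemma quantization_error_upper_entropy:
  assumes cube: "AE x in \<nu>. x \<in> half_open_unit_cube" and r: "r > 0" and s: "0 < s" "s < 1"
    and less: "lower_partition_entropy \<nu> r < ereal s"
  shows "\<exists>K>0. \<exists>\<^sub>F m in sequentially. quantization_error \<nu> r m \<le> K * real m powr (- ((1 - s) / (s * r)))"
proof -
  define K where "K = real CARD('d)"
  have K: "K > 0" by (simp add: K_def)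
  have freq: "\<exists>\<^sub>F x in at_top. ln (real (min_partition_card \<nu> r x)) / ln x < s"
    using frequently_Liminf_less[OF less[unfolded lower_partition_entropy_def]] by simp
  \<comment> \<open>This exponent only provides finite stopping families, hence an admissible
    partition at every scale.\<close>
  obtain q where q: "0 < q" "q < 1" "Lq_spectrum \<nu> q < ereal (r * q)"
    using subcritical_exponent_exists[OF r] by blast
  obtain n0 C where CS: "\<And>t. 0 < t \<Longrightarrow> t \<le> 1 \<Longrightarrow> finite (charged_stopping r n0 t)"
    using card_charged_stopping[OF r q(1,3)] by blast
  have "\<exists>\<^sub>F m in sequentially. quantization_error \<nu> r m \<le> K * real m powr (- ((1 - s) / (s * r)))"
    unfolding frequently_sequentially
  proof
    fix M :: nat
    have "filterlim (\<lambda>x. x powr s) at_top at_top" using s by real_asymp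
    then have "\<forall>\<^sub>F x in at_top. real M + 1 \<le> x powr s \<and> 1 < x"
      by (intro eventually_conj eventually_gt_at_top) (simp add: filterlim_at_top)
    from frequently_eventually_frequently[OF freq this]
    obtain x where x: "ln (real (min_partition_card \<nu> r x)) / ln x < s" "real M + 1 \<le> x powr s" "1 < x"
      by (auto dest!: frequently_ex)
    define S where "S = {card P | P. P \<in> dyadic_partitions \<nu> \<and> Max (cube_weight \<nu> r ` P) < 1 / x}"
    have t: "0 < 1 / x" "1 / x \<le> 1" using x by auto
    \<comment> \<open>Nonemptiness lets the infimum of a set of naturals be attained, so an optimal
      partition exists.\<close>
    have "S \<noteq> {}" using stopping_partition[OF cube r t(1) CS[OF t]] by (auto simp: S_def)
    then have "Inf S \<in> S" by (rule Inf_nat_def1)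
    then obtain P where P: "P \<in> dyadic_partitions \<nu>" "Max (cube_weight \<nu> r ` P) < 1 / x"
        and cP: "card P = min_partition_card \<nu> r x"
      by (auto simp: S_def min_partition_card_def)
    note PC = partition_codebook[OF cube P(1)]
    have "card P > 0" using PC by (simp add: card_gt_0_iff)
    have "ln (real (card P)) < ln (x powr s)"
      using x by (simp add: cP ln_powr pos_divide_less_eq)
    then have cs: "real (card P) < x powr s"
      using \<open>card P > 0\<close> x by (subst (asm) ln_less_cancel_iff) auto
    \<comment> \<open>Using x^s instead of \<open>card P\<close> makes m unbounded even if the
      partitions stay small, as for finitely supported measures.\<close>
    define m where "m = nat \<lfloor>x powr s\<rfloor>"
    have m: "card P \<le> m" "real m \<le> x powr s" "m \<ge> M" "m \<ge> 1"
      using cs x(2) unfolding m_def by linarith+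
    have "quantization_error \<nu> r m \<le> (real CARD('d) powr r * (real (card P) * (1 / x))) powr (1 / r)"
    proof (rule quantization_error_upper[OF r PC(1,2,4)])
      show "cube_weight \<nu> r Q \<le> 1 / x" if "Q \<in> P" for Q
        using P(2) that PC by (subst (asm) Max_less_iff) (auto intro: less_imp_le)
    qed (rule m(1))
    also have "\<dots> \<le> (real CARD('d) powr r * real m powr (- ((1 - s) / s))) powr (1 / r)"
    proof (intro powr_mono2 mult_left_mono)
      have "real (card P) * (1 / x) \<le> x powr s * (1 / x)"
        using cs x by (intro mult_right_mono) auto
      also have "\<dots> = (x powr s) powr (- ((1 - s) / s))"
        using x s by (simp add: powr_powr powr_diff)
      also have "\<dots> \<le> real m powr (- ((1 - s) / s))"
        using m s by (intro powr_mono2') auto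
      finally show "real (card P) * (1 / x) \<le> real m powr (- ((1 - s) / s))" .
    qed (use r x in auto)
    also have "\<dots> = K * real m powr (- ((1 - s) / (s * r)))"
      using r by (simp add: K_def powr_mult powr_powr)
    finally show "\<exists>m\<ge>M. quantization_error \<nu> r m \<le> K * real m powr (- ((1 - s) / (s * r)))"
      using m by blast
  qed
  with K show ?thesis by blast
qed

section \<open>Comparison of the quantities\<close>

lemma upper_quantization_dim_ge_critical:
  assumes r: "r > 0"
  shows "ereal (r * critical_exponent \<nu> r / (1 - critical_exponent \<nu> r)) \<le> upper_quantization_dim \<nu> r"
proof (rule ccontr)
  define p where "p = critical_exponent \<nu> r"
  have p: "0 \<le> p" "p < 1" using critical_exponent_nonneg[OF r] critical_exponent_less_1[OF r] by (auto simp: p_def)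
  assume "\<not> ?thesis"
  then have less: "upper_quantization_dim \<nu> r < ereal (r * p / (1 - p))" by (simp add: p_def)
  \<comment> \<open>If p = 0, the claim is the nonnegativity of the dimension; this leaves p > 0 and
    room for exponents below p.\<close>
  have "0 \<le> upper_quantization_dim \<nu> r"
    using lower_quantization_dim_nonneg[OF quantization_error_eventually_less_1[OF r]]
      lower_le_upper_quantization_dim order_trans by blast
  from le_less_trans[OF this less] have "0 < r * p / (1 - p)" by simp
  with p r have p0: "p > 0" by (simp add: zero_less_divide_iff zero_less_mult_iff)
  have "((\<lambda>q. ereal (r * q / (1 - q))) \<longlongrightarrow> ereal (r * p / (1 - p))) (at_left p)"
    using p by (intro tendsto_intros) auto
  then have "\<forall>\<^sub>F q in at_left p. upper_quantization_dim \<nu> r < ereal (r * q / (1 - q))"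
    using less by (rule order_tendstoD)
  moreover have "\<forall>\<^sub>F q in at_left p. q \<in> {0<..<p}" using p0 by (intro eventually_at_left_real)
  ultimately have "\<forall>\<^sub>F q in at_left p. False"
  proof eventually_elim
    case (elim q)
    then have q: "0 < q" "q < p" "q < 1" using p by auto
    obtain K where K: "K > 0"
      "\<exists>\<^sub>F m in sequentially. K * real m powr (- ((1 - q) / (q * r))) \<le> quantization_error \<nu> r m"
      using quantization_error_lower_frequently[OF r q(1)] q(2) unfolding p_def by blast
    have "(1 - q) / (q * r) > 0" using q r by simp
    from upper_quantization_dim_ge[OF K(1) this quantization_error_eventually_less_1[OF r] K(2)]
    have "ereal (r * q / (1 - q)) \<le> upper_quantization_dim \<nu> r" by (simp add: mult.commute)
    with elim show False by simp
  qed
  then show False by simp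
qed

lemma upper_quantization_dim_le_critical:
  assumes r: "r > 0"
  shows "upper_quantization_dim \<nu> r \<le> ereal (r * critical_exponent \<nu> r / (1 - critical_exponent \<nu> r))"
proof (rule tendsto_lowerbound)
  define p where "p = critical_exponent \<nu> r"
  have p: "0 \<le> p" "p < 1" using critical_exponent_nonneg[OF r] critical_exponent_less_1[OF r] by (auto simp: p_def)
  show "((\<lambda>q. ereal (r * q / (1 - q))) \<longlongrightarrow> ereal (r * critical_exponent \<nu> r / (1 - critical_exponent \<nu> r))) (at_right p)"
    unfolding p_def[symmetric] using p by (intro tendsto_intros) auto
  have "\<forall>\<^sub>F q in at_right p. q \<in> {p<..<1}" using p by (intro eventually_at_right_real)
  then show "\<forall>\<^sub>F q in at_right p. upper_quantization_dim \<nu> r \<le> ereal (r * q / (1 - q))"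
  proof eventually_elim
    case (elim q)
    then show ?case
      using p spectrum_above_critical[OF r, of q]
      by (intro upper_quantization_dim_le_subcritical[OF r]) (auto simp: p_def)
  qed
qed simp

lemma upper_quantization_dim_eq:
  assumes "r > 0"
  shows "upper_quantization_dim \<nu> r = ereal (r * critical_exponent \<nu> r / (1 - critical_exponent \<nu> r))"
  using upper_quantization_dim_ge_critical[OF assms] upper_quantization_dim_le_critical[OF assms] by (rule antisym[rotated])

text \<open>The map q -> r q / (1 - q) is increasing on q < 1, so exponents can be recovered from
  dimensions.\<close>

lemma le_if_quotient_le:
  fixes s p :: real
  assumes "r > 0" "s < 1" "p < 1" "r * s / (1 - s) \<le> r * p / (1 - p)"
  shows "s \<le> p"
proof -
  have "r * s / (1 - s) * ((1 - s) * (1 - p)) \<le> r * p / (1 - p) * ((1 - s) * (1 - p))"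
    using assms by (intro mult_right_mono) auto
  also have "r * s / (1 - s) * ((1 - s) * (1 - p)) = r * s * (1 - p)" using assms by simp
  also have "r * p / (1 - p) * ((1 - s) * (1 - p)) = r * p * (1 - s)" using assms by simp
  finally have "r * s \<le> r * p" by (simp add: algebra_simps)
  then show ?thesis using assms by simp
qed

lemma lower_quantization_dim_ge_coarse_aux:
  assumes r: "r > 0" and s: "s > 0" "ereal s < lower_coarse_dim \<nu> r"
  shows "s < 1" "ereal (r * s / (1 - s)) \<le> lower_quantization_dim \<nu> r"
proof -
  obtain K where s1: "s < 1" and K: "K > 0"
    "\<forall>\<^sub>F m in sequentially. K * real m powr (- ((1 - s) / (s * r))) \<le> quantization_error \<nu> r m"
    using quantization_error_lower_coarse[OF r s] by blast
  have "(1 - s) / (s * r) > 0" using s s1 r by simp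
  from lower_quantization_dim_ge[OF K(1) this quantization_error_eventually_less_1[OF r] K(2)]
  show "ereal (r * s / (1 - s)) \<le> lower_quantization_dim \<nu> r" by (simp add: mult.commute)
  show "s < 1" by (rule s1)
qed

text \<open>An s between the two would force the lower dimension above the upper one. In particular
  the coarse dimension is below 1.\<close>

lemma lower_coarse_dim_le_critical:
  assumes r: "r > 0"
  shows "lower_coarse_dim \<nu> r \<le> ereal (critical_exponent \<nu> r)"
proof (rule ccontr)
  assume "\<not> ?thesis"
  then obtain s where s: "critical_exponent \<nu> r < s" "ereal s < lower_coarse_dim \<nu> r"
    using ereal_dense2 by (force simp: not_le)
  then have s0: "s > 0" using critical_exponent_nonneg[OF r] by linarith
  note * = lower_quantization_dim_ge_coarse_aux[OF r s0 s(2)]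
  have "ereal (r * s / (1 - s)) \<le> upper_quantization_dim \<nu> r"
    using *(2) lower_le_upper_quantization_dim by (rule order_trans)
  then have "r * s / (1 - s) \<le> r * critical_exponent \<nu> r / (1 - critical_exponent \<nu> r)"
    by (simp add: upper_quantization_dim_eq[OF r])
  then have "s \<le> critical_exponent \<nu> r"
    by (rule le_if_quotient_le[OF r *(1) critical_exponent_less_1[OF r]])
  with s show False by simp
qed

lemma lower_quantization_dim_ge_coarse:
  assumes r: "r > 0"
  shows "ereal r * lower_coarse_dim \<nu> r / (1 - lower_coarse_dim \<nu> r) \<le> lower_quantization_dim \<nu> r"
proof -
  obtain F where F: "lower_coarse_dim \<nu> r = ereal F" "0 \<le> F" "F < 1"
    using lower_coarse_dim_le_critical[OF r] critical_exponent_less_1[OF r] lower_coarse_dim_nonneg[of r]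
    by (cases "lower_coarse_dim \<nu> r") auto
  have "ereal (r * F / (1 - F)) \<le> lower_quantization_dim \<nu> r"
  proof (cases "F = 0")
    case True
    then show ?thesis
      using lower_quantization_dim_nonneg[OF quantization_error_eventually_less_1[OF r]]
      by (simp flip: zero_ereal_def)
  next
    case False
    show ?thesis
    proof (rule tendsto_upperbound)
      show "((\<lambda>s. ereal (r * s / (1 - s))) \<longlongrightarrow> ereal (r * F / (1 - F))) (at_left F)"
        using F by (intro tendsto_intros) auto
      have "\<forall>\<^sub>F s in at_left F. s \<in> {0<..<F}" using F False by (intro eventually_at_left_real) auto
      then show "\<forall>\<^sub>F s in at_left F. ereal (r * s / (1 - s)) \<le> lower_quantization_dim \<nu> r"
        by eventually_elim (use lower_quantization_dim_ge_coarse_aux(2)[OF r] F in auto)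
    qed simp
  qed
  then show ?thesis using F by (simp add: one_ereal_def)
qed

section \<open>Order zero\<close>

text \<open>Jensen's inequality: the geometric mean of the distance is at most its arithmetic mean
  c. If the negative part has infinite integral, the error of order 0 is 0.\<close>

lemma codebook_error_0_le_1:
  assumes "\<alpha> \<noteq> {}"
  shows "codebook_error \<nu> 0 \<alpha> \<le> codebook_error \<nu> 1 \<alpha>"
proof -
  define d where "d x = infdist x \<alpha>" for x
  define c where "c = integral\<^sup>L \<nu> d"
  have int: "integrable \<nu> d"
    using integrable_infdist_powr[of 1 \<alpha>] by (simp add: d_def[abs_def] infdist_nonneg)
  have c0: "c \<ge> 0" unfolding c_def by (intro integral_nonneg_AE) (simp add: d_def infdist_nonneg)
  have e1: "codebook_error \<nu> 1 \<alpha> = c"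
    using c0 by (simp add: codebook_error_def c_def d_def[abs_def] infdist_nonneg)
  define P N where "P = (\<integral>\<^sup>+ x. e2ennreal (log_infdist \<alpha> x) \<partial>\<nu>)"
    and "N = (\<integral>\<^sup>+ x. e2ennreal (- log_infdist \<alpha> x) \<partial>\<nu>)"
  have ld: "log_distortion \<nu> \<alpha> = enn2ereal P - enn2ereal N"
    by (simp add: log_distortion_def P_def N_def)
  have e0: "codebook_error \<nu> 0 \<alpha> = (if log_distortion \<nu> \<alpha> = -\<infinity> then 0 else exp (real_of_ereal (log_distortion \<nu> \<alpha>)))"
    by (simp add: codebook_error_def)
  have meas[measurable]: "d \<in> borel_measurable \<nu>" unfolding d_def by (rule measurable_infdist)
  have Pfin: "P < \<infinity>"
  proof -
    \<comment> \<open>From ln y \<le> y the positive part is dominated by the integrable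
      distance.\<close>
    have "e2ennreal (log_infdist \<alpha> x) \<le> ennreal (d x)" for x
    proof (cases "d x = 0")
      case False
      then have "d x > 0" using infdist_nonneg[of x \<alpha>] by (simp add: d_def)
      then have "ln (d x) \<le> d x" using ln_le_minus_one[of "d x"] by linarith
      then show ?thesis
        using False by (simp add: log_infdist_def d_def ennreal_leI)
    qed (simp add: log_infdist_def d_def e2ennreal_neg)
    then have "P \<le> (\<integral>\<^sup>+ x. ennreal (d x) \<partial>\<nu>)" unfolding P_def by (rule nn_integral_mono)
    also have "\<dots> = ennreal c"
      unfolding c_def by (intro nn_integral_eq_integral int) (simp add: d_def infdist_nonneg)
    finally show ?thesis by (simp add: le_less_trans)
  qed
  show ?thesis
  proof (cases "N = \<infinity>")
    case True
    then have "log_distortion \<nu> \<alpha> = -\<infinity>" using Pfin by (cases P) (auto simp: ld)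
    then show ?thesis by (simp add: e0 e1 c0)
  next
    case False
    have mlog[measurable]: "log_infdist \<alpha> \<in> borel_measurable \<nu>"
    proof -
      have "log_infdist \<alpha> = (\<lambda>x. if d x = 0 then -\<infinity> else ereal (ln (d x)))"
        by (auto simp: log_infdist_def d_def fun_eq_iff)
      then show ?thesis by simp
    qed
    have "AE x in \<nu>. e2ennreal (- log_infdist \<alpha> x) \<noteq> \<infinity>"
      using False unfolding N_def by (intro nn_integral_PInf_AE) auto
    then have AEd: "AE x in \<nu>. d x > 0"
    proof eventually_elim
      case (elim x)
      then show ?case using infdist_nonneg[of x \<alpha>]
        by (cases "d x = 0") (auto simp: log_infdist_def d_def)
    qed
    have c_pos: "c > 0"
    proof (rule ccontr)
      assume "\<not> c > 0"
      then have "integral\<^sup>L \<nu> d = 0" using c0 by (simp add: c_def)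
      then have "AE x in \<nu>. d x = 0"
        using int by (subst (asm) integral_nonneg_eq_0_iff_AE) (auto simp: d_def infdist_nonneg)
      with AEd have "AE x in \<nu>. False" by eventually_elim simp
      then show False by simp
    qed
    have P_eq: "P = (\<integral>\<^sup>+ x. ennreal (ln (d x)) \<partial>\<nu>)"
      unfolding P_def using AEd
      by (intro nn_integral_cong_AE) (elim eventually_mono, simp add: log_infdist_def d_def)
    have N_eq: "N = (\<integral>\<^sup>+ x. ennreal (- ln (d x)) \<partial>\<nu>)"
      unfolding N_def using AEd
      by (intro nn_integral_cong_AE) (elim eventually_mono, simp add: log_infdist_def d_def)
    have lint: "integrable \<nu> (\<lambda>x. ln (d x))"
      unfolding real_integrable_def using Pfin False by (auto simp: P_eq N_eq)
    have "log_distortion \<nu> \<alpha> = ereal (integral\<^sup>L \<nu> (\<lambda>x. ln (d x)))"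
      using Pfin False unfolding ld real_lebesgue_integral_def[OF lint] P_eq[symmetric] N_eq[symmetric]
      by (cases P; cases N) (auto)
    then have e0': "codebook_error \<nu> 0 \<alpha> = exp (integral\<^sup>L \<nu> (\<lambda>x. ln (d x)))" by (simp add: e0)
    have "integral\<^sup>L \<nu> (\<lambda>x. ln (d x)) \<le> integral\<^sup>L \<nu> (\<lambda>x. ln c + (d x / c - 1))"
    proof (rule integral_mono_AE[OF lint])
      \<comment> \<open>The tangent of the logarithm at c, whose integral is exactly
        \<open>ln c\<close>.\<close>
      show "AE x in \<nu>. ln (d x) \<le> ln c + (d x / c - 1)"
        using AEd
      proof eventually_elim
        case (elim x)
        then show ?case using ln_le_minus_one[of "d x / c"] c_pos by (simp add: ln_div)
      qed
    qed (use int in simp)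
    also have "\<dots> = ln c" using int c_pos by (simp add: c_def[symmetric] prob_space)
    finally show ?thesis using c_pos unfolding e0' e1 by (metis exp_le_cancel_iff exp_ln)
  qed
qed

lemma quantization_error_0_le_1:
  assumes "m \<ge> 1"
  shows "quantization_error \<nu> 0 m \<le> quantization_error \<nu> 1 m"
  unfolding quantization_error_def[of _ 1]
proof (intro cINF_greatest codebooks_nonempty assms)
  fix \<alpha> :: "(real^'d) set" assume \<alpha>: "\<alpha> \<in> codebooks m"
  then have "\<alpha> \<noteq> {}" by (auto simp: codebooks_def)
  from order_trans[OF quantization_error_le[OF \<alpha>] codebook_error_0_le_1[OF this]]
  show "quantization_error \<nu> 0 m \<le> codebook_error \<nu> 1 \<alpha>" .
qed

text \<open>Every q in (0, 1) is subcritical when the spectrum vanishes, so the upper dimension is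
  at most s q / (1 - q), which tends to 0 with q.\<close>

lemma has_quantization_dim_0:
  assumes "\<And>x. x > 0 \<Longrightarrow> Lq_spectrum \<nu> x = 0" and "r \<ge> 0"
  shows "has_quantization_dim \<nu> r 0"
proof -
  \<comment> \<open>Order 0 is controlled by order 1.\<close>
  define s where "s = (if r = 0 then 1 else r)"
  have s: "s > 0" using assms(2) by (auto simp: s_def)
  have le: "\<forall>\<^sub>F m in sequentially. quantization_error \<nu> r m \<le> quantization_error \<nu> s m"
    using eventually_ge_at_top[of 1] by eventually_elim (simp add: s_def quantization_error_0_le_1)
  have "upper_quantization_dim \<nu> r \<le> ereal (s * q / (1 - q))" if q: "0 < q" "q < 1" for q
  proof -
    have "Lq_spectrum \<nu> q < ereal (s * q)" using assms(1)[OF q(1)] q s by simp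
    then obtain K where K: "K > 0"
      and ev: "\<forall>\<^sub>F m in sequentially. quantization_error \<nu> s m \<le> K * real m powr (- ((1 - q) / (q * s)))"
      using quantization_error_upper_subcritical[OF s q] by blast
    have pos: "(1 - q) / (q * s) > 0" using q s by simp
    have "\<forall>\<^sub>F m in sequentially. quantization_error \<nu> r m \<le> K * real m powr (- ((1 - q) / (q * s)))"
      using le ev by eventually_elim simp
    from upper_quantization_dim_le[OF K pos this] show ?thesis by (simp add: mult.commute)
  qed
  then have "\<forall>\<^sub>F q in at_right 0. upper_quantization_dim \<nu> r \<le> ereal (s * q / (1 - q))"
    using eventually_at_right_real[of 0 1] by (auto elim!: eventually_mono)
  moreover have "((\<lambda>q. ereal (s * q / (1 - q))) \<longlongrightarrow> ereal (s * 0 / (1 - 0))) (at_right 0)"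
    by (intro tendsto_intros) auto
  ultimately have "upper_quantization_dim \<nu> r \<le> ereal (s * 0 / (1 - 0))"
    by (intro tendsto_lowerbound) auto
  then have up: "upper_quantization_dim \<nu> r \<le> 0" by (simp add: zero_ereal_def)
  have "\<forall>\<^sub>F m in sequentially. quantization_error \<nu> r m < 1"
    using le quantization_error_eventually_less_1[OF s] by eventually_elim simp
  then have "0 \<le> lower_quantization_dim \<nu> r" by (rule lower_quantization_dim_nonneg)
  with up lower_le_upper_quantization_dim[of \<nu> r] show ?thesis
    unfolding has_quantization_dim_def by (metis order_antisym order_trans)
qed

end

section \<open>Similarities\<close>

text \<open>One inequality is enough: for nonzero a, the reverse estimate of the errors comes from
  applying it to the inverse map.\<close>

lemma infdist_similarity:
  fixes \<alpha> :: "'a::real_normed_vector set"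
  assumes "\<alpha> \<noteq> {}"
  shows "infdist (a *\<^sub>R x + b) ((\<lambda>x. a *\<^sub>R x + b) ` \<alpha>) \<le> \<bar>a\<bar> * infdist x \<alpha>"
proof (cases "a = 0")
  case True
  with assms show ?thesis by (auto simp: image_constant_conv)
next
  case False
  have "infdist (a *\<^sub>R x + b) ((\<lambda>x. a *\<^sub>R x + b) ` \<alpha>) / \<bar>a\<bar> \<le> infdist x \<alpha>"
    unfolding infdist_notempty[OF assms]
  proof (intro cINF_greatest assms)
    fix y assume "y \<in> \<alpha>"
    then have "infdist (a *\<^sub>R x + b) ((\<lambda>x. a *\<^sub>R x + b) ` \<alpha>) \<le> dist (a *\<^sub>R x + b) (a *\<^sub>R y + b)"
      by (intro infdist_le) auto
    also have "\<dots> = \<bar>a\<bar> * dist x y"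
      by (simp add: dist_norm flip: scaleR_diff_right)
    finally show "infdist (a *\<^sub>R x + b) ((\<lambda>x. a *\<^sub>R x + b) ` \<alpha>) / \<bar>a\<bar> \<le> dist x y"
      using False by (simp add: divide_le_eq mult.commute)
  qed
  then show ?thesis using False by (simp add: divide_le_eq mult.commute)
qed

lemma (in bounded_prob) bounded_prob_similarity:
  "\<exists>C. bounded_prob (distr \<nu> borel (\<lambda>x. a *\<^sub>R x + b)) C"
proof -
  have m[measurable]: "(\<lambda>x. a *\<^sub>R x + b) \<in> measurable \<nu> borel"
    unfolding measurable_cong_sets[OF sets_eq refl]
    by (intro borel_measurable_continuous_onI continuous_intros)
  interpret D: prob_space "distr \<nu> borel (\<lambda>x. a *\<^sub>R x + b)" by (rule prob_space_distr) measurable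
  define C where "C = \<bar>a\<bar> * B + norm b"
  have "AE x in distr \<nu> borel (\<lambda>x. a *\<^sub>R x + b). \<forall>i. \<bar>x $ i\<bar> \<le> C"
  proof (subst AE_distr_iff)
    show "{x \<in> space borel. \<forall>i. \<bar>x $ i\<bar> \<le> C} \<in> sets borel" by measurable
    show "AE x in \<nu>. \<forall>i. \<bar>(a *\<^sub>R x + b) $ i\<bar> \<le> C"
      using bounded
    proof eventually_elim
      case (elim x)
      show ?case
      proof
        fix i
        have "\<bar>(a *\<^sub>R x + b) $ i\<bar> \<le> \<bar>a\<bar> * \<bar>x $ i\<bar> + \<bar>b $ i\<bar>"
          using abs_triangle_ineq[of "a * x $ i" "b $ i"] by (simp add: abs_mult)
        also have "\<dots> \<le> C"
          unfolding C_def using elim component_le_norm_cart[of b i] by (intro add_mono mult_left_mono) auto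
        finally show "\<bar>(a *\<^sub>R x + b) $ i\<bar> \<le> C" .
      qed
    qed
  qed measurable
  then have "bounded_prob (distr \<nu> borel (\<lambda>x. a *\<^sub>R x + b)) C"
    by unfold_locales auto
  then show ?thesis ..
qed

lemma (in bounded_prob) quantization_error_similarity:
  assumes r: "r > 0" and m: "m \<ge> 1" and a: "a \<noteq> 0"
  shows "quantization_error (distr \<nu> borel (\<lambda>x. a *\<^sub>R x + b)) r m \<le> \<bar>a\<bar> * quantization_error \<nu> r m"
proof -
  define f where "f x = a *\<^sub>R x + b" for x :: "real^'d"
  have f[measurable]: "f \<in> measurable \<nu> borel"
    unfolding measurable_cong_sets[OF sets_eq refl] f_def
    by (intro borel_measurable_continuous_onI continuous_intros)
  obtain C where "bounded_prob (distr \<nu> borel f) C"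
    using bounded_prob_similarity[of a b] by (auto simp: f_def[abs_def])
  then interpret D: bounded_prob "distr \<nu> borel f" C .
  have "quantization_error (distr \<nu> borel f) r m / \<bar>a\<bar> \<le> quantization_error \<nu> r m"
    unfolding quantization_error_def[of \<nu>]
  proof (intro cINF_greatest codebooks_nonempty m)
    fix \<alpha> :: "(real^'d) set" assume \<alpha>: "\<alpha> \<in> codebooks m"
    then have ne: "\<alpha> \<noteq> {}" and fin: "finite \<alpha>" by (auto simp: codebooks_def)
    have "card (f ` \<alpha>) \<le> card \<alpha>" "card (f ` \<alpha>) \<ge> 1"
      using fin ne by (auto simp: card_image_le Suc_le_eq card_gt_0_iff)
    then have "f ` \<alpha> \<in> codebooks m" using \<alpha> by (auto simp: codebooks_def)
    then have "quantization_error (distr \<nu> borel f) r m \<le> codebook_error (distr \<nu> borel f) r (f ` \<alpha>)"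
      by (rule quantization_error_le)
    also have "\<dots> = (\<integral>x. infdist (f x) (f ` \<alpha>) powr r \<partial>\<nu>) powr (1 / r)"
      using r D.measurable_infdist[of "f ` \<alpha>"] by (simp add: codebook_error_def integral_distr)
    also have "\<dots> \<le> (\<integral>x. \<bar>a\<bar> powr r * infdist x \<alpha> powr r \<partial>\<nu>) powr (1 / r)"
    proof (intro powr_mono2 integral_mono_AE')
      show "AE x in \<nu>. infdist (f x) (f ` \<alpha>) powr r \<le> \<bar>a\<bar> powr r * infdist x \<alpha> powr r"
        using infdist_similarity[OF ne, of a _ b] r
        by (auto simp: f_def[abs_def] infdist_nonneg intro!: powr_mono2 simp flip: powr_mult)
    qed (use r integrable_infdist_powr[of r \<alpha>] in auto)
    also have "\<dots> = \<bar>a\<bar> * codebook_error \<nu> r \<alpha>"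
      using r by (simp add: codebook_error_def powr_mult powr_powr)
    finally show "quantization_error (distr \<nu> borel f) r m / \<bar>a\<bar> \<le> codebook_error \<nu> r \<alpha>"
      using a by (simp add: divide_le_eq mult.commute)
  qed
  then show ?thesis using a by (simp add: f_def[abs_def] divide_le_eq mult.commute)
qed

lemma (in bounded_prob) quantization_error_similarity_inverse:
  assumes r: "r > 0" and m: "m \<ge> 1" and a: "a \<noteq> 0"
  shows "quantization_error \<nu> r m \<le> quantization_error (distr \<nu> borel (\<lambda>x. a *\<^sub>R x + b)) r m / \<bar>a\<bar>"
proof -
  obtain C where "bounded_prob (distr \<nu> borel (\<lambda>x. a *\<^sub>R x + b)) C"
    using bounded_prob_similarity[of a b] by auto
  then interpret D: bounded_prob "distr \<nu> borel (\<lambda>x. a *\<^sub>R x + b)" C .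
  have m1: "(\<lambda>x. a *\<^sub>R x + b) \<in> measurable \<nu> borel"
    unfolding measurable_cong_sets[OF sets_eq refl]
    by (intro borel_measurable_continuous_onI continuous_intros)
  have m2: "(\<lambda>x. (1 / a) *\<^sub>R x + (- (1 / a) *\<^sub>R b)) \<in> measurable borel borel"
    by (intro borel_measurable_continuous_onI continuous_intros)
  have "distr (distr \<nu> borel (\<lambda>x. a *\<^sub>R x + b)) borel (\<lambda>x. (1 / a) *\<^sub>R x + (- (1 / a) *\<^sub>R b))
      = distr \<nu> borel (\<lambda>x. x)"
    using a by (subst distr_distr[OF m2 m1]) (simp add: o_def scaleR_add_right)
  also have "\<dots> = \<nu>" by (rule distr_id2) (simp add: sets_eq)
  finally show ?thesis
    using D.quantization_error_similarity[OF r m, of "1 / a" "- (1 / a) *\<^sub>R b"] a by simp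
qed

text \<open>Both error estimates are proved for the image measure \<mu> and carried back to \<nu>
  with constant K / \<bar>a\<bar>. The second inequality uses that the entropy is at most the
  critical exponent of \<mu>, below which errors of \<mu> are large for infinitely many m.\<close>

lemma (in bounded_prob) partition_entropy_bounds:
  assumes r: "r > 0" and a: "a \<noteq> 0"
    and cube: "AE x in \<nu>. a *\<^sub>R x + b \<in> half_open_unit_cube"
  defines "h \<equiv> lower_partition_entropy (distr \<nu> borel (\<lambda>x. a *\<^sub>R x + b)) r"
  shows "lower_quantization_dim \<nu> r \<le> ereal r * h / (1 - h)"
    and "ereal r * h / (1 - h) \<le> upper_quantization_dim \<nu> r"
proof -
  define \<mu> where "\<mu> = distr \<nu> borel (\<lambda>x. a *\<^sub>R x + b)"
  obtain C where "bounded_prob \<mu> C"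
    using bounded_prob_similarity[of a b] by (auto simp: \<mu>_def)
  then interpret D: bounded_prob \<mu> C .
  have m1: "(\<lambda>x. a *\<^sub>R x + b) \<in> measurable \<nu> borel"
    unfolding measurable_cong_sets[OF sets_eq refl]
    by (intro borel_measurable_continuous_onI continuous_intros)
  have "(half_open_unit_cube :: (real^'d) set) \<in> sets borel"
    by (simp add: sets_dyadic_cube flip: dyadic_cube_0_0)
  then have cube': "AE x in \<mu>. x \<in> half_open_unit_cube"
    unfolding \<mu>_def by (subst AE_distr_iff[OF m1]) (auto simp: cube)
  obtain H where H: "h = ereal H" "0 \<le> H" "H \<le> critical_exponent \<mu> r"
    using D.lower_partition_entropy_nonneg[of r] D.lower_partition_entropy_le_critical[OF cube' r]
    unfolding h_def \<mu>_def[symmetric] by (cases "lower_partition_entropy \<mu> r") auto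
  have p: "critical_exponent \<mu> r < 1" by (rule D.critical_exponent_less_1[OF r])
  with H have H1: "H < 1" by simp
  have eq: "ereal r * h / (1 - h) = ereal (r * H / (1 - H))"
    using H H1 by (simp add: one_ereal_def)
  have "lower_quantization_dim \<nu> r \<le> ereal (r * s / (1 - s))" if s: "H < s" "s < 1" for s
  proof -
    have s0: "s > 0" using s H by simp
    have "lower_partition_entropy \<mu> r < ereal s" using H s by (simp add: h_def \<mu>_def)
    then obtain K where K: "K > 0" and
      fr: "\<exists>\<^sub>F m in sequentially. quantization_error \<mu> r m \<le> K * real m powr (- ((1 - s) / (s * r)))"
      using D.quantization_error_upper_entropy[OF cube' r s0 s(2)] by blast
    have "\<exists>\<^sub>F m in sequentially. quantization_error \<nu> r m \<le> K / \<bar>a\<bar> * real m powr (- ((1 - s) / (s * r)))"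
      using frequently_eventually_frequently[OF fr eventually_ge_at_top[of 1]]
    proof (rule frequently_elim1, elim conjE)
      fix m :: nat
      assume "quantization_error \<mu> r m \<le> K * real m powr (- ((1 - s) / (s * r)))" "1 \<le> m"
      then have "quantization_error \<mu> r m / \<bar>a\<bar> \<le> K * real m powr (- ((1 - s) / (s * r))) / \<bar>a\<bar>"
        using a by (intro divide_right_mono) auto
      with quantization_error_similarity_inverse[OF r \<open>1 \<le> m\<close> a, of b]
      show "quantization_error \<nu> r m \<le> K / \<bar>a\<bar> * real m powr (- ((1 - s) / (s * r)))"
        by (simp add: \<mu>_def)
    qed
    moreover have "K / \<bar>a\<bar> > 0" "(1 - s) / (s * r) > 0" using K a s s0 r by auto
    ultimately show ?thesis using lower_quantization_dim_le by (fastforce simp: mult.commute)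
  qed
  then have "\<forall>\<^sub>F s in at_right H. lower_quantization_dim \<nu> r \<le> ereal (r * s / (1 - s))"
    using eventually_at_right_real[OF H1] by (auto elim!: eventually_mono)
  moreover have "((\<lambda>s. ereal (r * s / (1 - s))) \<longlongrightarrow> ereal (r * H / (1 - H))) (at_right H)"
    using H1 by (intro tendsto_intros) auto
  ultimately show "lower_quantization_dim \<nu> r \<le> ereal r * h / (1 - h)"
    unfolding eq by (intro tendsto_lowerbound) auto
  have ge: "ereal (r * q / (1 - q)) \<le> upper_quantization_dim \<nu> r"
    if q: "0 < q" "q < critical_exponent \<mu> r" for q
  proof -
    obtain K where K: "K > 0" and
      fr: "\<exists>\<^sub>F m in sequentially. K * real m powr (- ((1 - q) / (q * r))) \<le> quantization_error \<mu> r m"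
      using D.quantization_error_lower_frequently[OF r q] by blast
    have "\<exists>\<^sub>F m in sequentially. K / \<bar>a\<bar> * real m powr (- ((1 - q) / (q * r))) \<le> quantization_error \<nu> r m"
      using frequently_eventually_frequently[OF fr eventually_ge_at_top[of 1]]
    proof (rule frequently_elim1, elim conjE)
      fix m :: nat
      assume le: "K * real m powr (- ((1 - q) / (q * r))) \<le> quantization_error \<mu> r m" "1 \<le> m"
      have "K * real m powr (- ((1 - q) / (q * r))) \<le> \<bar>a\<bar> * quantization_error \<nu> r m"
        using le quantization_error_similarity[OF r \<open>1 \<le> m\<close> a, of b] by (simp add: \<mu>_def)
      then show "K / \<bar>a\<bar> * real m powr (- ((1 - q) / (q * r))) \<le> quantization_error \<nu> r m"
        using a by (simp add: divide_le_eq mult.commute)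
    qed
    moreover have "K / \<bar>a\<bar> > 0" "(1 - q) / (q * r) > 0" using K a q p r by auto
    ultimately show ?thesis
      using upper_quantization_dim_ge quantization_error_eventually_less_1[OF r]
      by (fastforce simp: mult.commute)
  qed
  show "ereal r * h / (1 - h) \<le> upper_quantization_dim \<nu> r"
  \<comment> \<open>For H = 0 there is no positive exponent below H, and the claim is nonnegativity
    of the dimension.\<close>
  proof (cases "H = 0")
    case True
    then show ?thesis
      unfolding eq
      using lower_quantization_dim_nonneg[OF quantization_error_eventually_less_1[OF r]]
        lower_le_upper_quantization_dim[of \<nu> r] by (simp flip: zero_ereal_def)
  next
    case False
    show ?thesis unfolding eq
    proof (rule tendsto_upperbound)
      show "((\<lambda>q. ereal (r * q / (1 - q))) \<longlongrightarrow> ereal (r * H / (1 - H))) (at_left H)"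
        using H1 by (intro tendsto_intros) auto
      have "\<forall>\<^sub>F q in at_left H. q \<in> {0<..<H}" using H False by (intro eventually_at_left_real) auto
      then show "\<forall>\<^sub>F q in at_left H. ereal (r * q / (1 - q)) \<le> upper_quantization_dim \<nu> r"
        by eventually_elim (use ge H in auto)
    qed simp
  qed
qed

section \<open>Compactly supported measures\<close>

text \<open>By second countability the complement of the support is a union of countably many null
  basic open sets.\<close>

lemma AE_measure_support:
  fixes \<nu> :: "'a::second_countable_topology measure"
  assumes "sets \<nu> = sets borel"
  shows "AE x in \<nu>. x \<in> measure_support \<nu>"
proof -
  obtain A :: "'a set set" where A: "countable A" "topological_basis A"
    using ex_countable_basis by blast
  have "AE x in \<nu>. \<forall>U\<in>A. emeasure \<nu> U = 0 \<longrightarrow> x \<notin> U"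
  proof (subst AE_ball_countable[OF A(1)], intro ballI)
    fix U assume "U \<in> A"
    then have U: "U \<in> sets \<nu>" using A topological_basis_open assms by (metis borel_open)
    show "AE x in \<nu>. emeasure \<nu> U = 0 \<longrightarrow> x \<notin> U"
      using U by (cases "emeasure \<nu> U = 0") (auto intro!: AE_not_in simp: null_sets_def)
  qed
  then show ?thesis
  proof eventually_elim
    case (elim x)
    show ?case unfolding measure_support_def
    proof (intro CollectI allI impI, elim conjE)
      fix U assume U: "open U" "x \<in> U"
      then obtain V where V: "V \<in> A" "x \<in> V" "V \<subseteq> U"
        using topological_basisE[OF A(2)] by metis
      then have "emeasure \<nu> V > 0" using elim by (auto simp: zero_less_iff_neq_zero)
      also have "emeasure \<nu> V \<le> emeasure \<nu> U" using V U assms by (intro emeasure_mono) auto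
      finally show "emeasure \<nu> U > 0" .
    qed
  qed
qed

theorem theorem1p1:
  fixes \<nu> :: "(real^'d::finite) measure"
  assumes "prob_space \<nu>"
    and "sets \<nu> = sets borel"
    and "compact (measure_support \<nu>)"
  shows
    "((SUP x\<in>{0<..<1}. Lq_spectrum \<nu> x) > 0 \<longrightarrow>
        (\<forall>r>0.
           ereal r * lower_coarse_dim \<nu> r / (1 - lower_coarse_dim \<nu> r)
             \<le> lower_quantization_dim \<nu> r \<and>
           (\<forall>(a::real) (b::real^'d).
              a \<noteq> 0 \<and> (\<lambda>x. a *\<^sub>R x + b) ` measure_support \<nu> \<subseteq> half_open_unit_cube \<longrightarrow>
              (let h = lower_partition_entropy (distr \<nu> borel (\<lambda>x. a *\<^sub>R x + b)) r
               in lower_quantization_dim \<nu> r \<le> ereal r * h / (1 - h) \<and>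
                  ereal r * h / (1 - h) \<le> upper_quantization_dim \<nu> r)) \<and>
           upper_quantization_dim \<nu> r = upper_renyi_dim \<nu> (critical_exponent \<nu> r))) \<and>
     ((\<forall>x>0. Lq_spectrum \<nu> x = 0) \<longrightarrow>
        (\<forall>r\<ge>0. has_quantization_dim \<nu> r 0))"
proof -
  note supp = AE_measure_support[OF assms(2)]
  obtain B where B: "\<And>x. x \<in> measure_support \<nu> \<Longrightarrow> norm x \<le> B"
    using compact_imp_bounded[OF assms(3)] by (auto simp: bounded_iff)
  interpret prob_space \<nu> by fact
  have "AE x in \<nu>. \<forall>i. \<bar>x $ i\<bar> \<le> B"
    using supp
  proof eventually_elim
    case (elim x)
    then show ?case using B[of x] component_le_norm_cart[of x] by (meson order_trans)
  qed
  then interpret bounded_prob \<nu> B by unfold_locales (use assms(2) in auto)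
  show ?thesis
  proof (intro conjI impI allI)
    fix r :: real assume pos: "(SUP x\<in>{0<..<1}. Lq_spectrum \<nu> x) > 0" and r: "r > 0"
    show "ereal r * lower_coarse_dim \<nu> r / (1 - lower_coarse_dim \<nu> r) \<le> lower_quantization_dim \<nu> r"
      by (rule lower_quantization_dim_ge_coarse[OF r])
    show "upper_quantization_dim \<nu> r = upper_renyi_dim \<nu> (critical_exponent \<nu> r)"
      by (simp add: upper_quantization_dim_eq[OF r]
          upper_renyi_dim_at_critical[OF r critical_exponent_pos[OF r pos]])
    fix a :: real and b :: "real^'d"
    assume ab: "a \<noteq> 0 \<and> (\<lambda>x. a *\<^sub>R x + b) ` measure_support \<nu> \<subseteq> half_open_unit_cube"
    have "AE x in \<nu>. a *\<^sub>R x + b \<in> half_open_unit_cube"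
      using supp by eventually_elim (use ab in blast)
    from partition_entropy_bounds[OF r _ this] ab
    show "let h = lower_partition_entropy (distr \<nu> borel (\<lambda>x. a *\<^sub>R x + b)) r
               in lower_quantization_dim \<nu> r \<le> ereal r * h / (1 - h) \<and>
                  ereal r * h / (1 - h) \<le> upper_quantization_dim \<nu> r"
      by (simp add: Let_def)
  next
    fix r :: real assume "\<forall>x>0. Lq_spectrum \<nu> x = 0" "r \<ge> 0"
    then show "has_quantization_dim \<nu> r 0" by (intro has_quantization_dim_0) auto
  qed
qed

end
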